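(* Let $\mathcal{L}_w^2(\Omega)$ be separable with an orthonormal basis $\phi_0=1,\phi_1,\phi_2,\ldots$ (that is, an orthonormal sequence whose linear span is dense in $\mathcal{L}_w^2(\Omega)$). Let $g:\Omega\to\mathbb{R}$ be a bounded real (measurable) function, and let $\mathsf{E}(t)$, $t\in\mathbb{R}$, be the spectral family of the multiplication operator $\mathsf{M}[g]$. Let $f:\mathbb{R}\to\mathbb{R}$ be a bounded piecewise continuous function, let $K\subset\mathbb{R}$ be the set of discontinuities of $f$ and $\overline{K}$ its closure, and suppose that $$\int_{\overline{K}}d\mathsf{E}(t)=\mathsf{0}.$$ For each $n$ let $\boldsymbol{M}_n[g]$ be the $(n+1)\times(n+1)$ Hermitian matrix with elements $[\boldsymbol{M}_n[g]]_{i,j}=\langle\phi_i,g\,\phi_j\rangle$, $i,j=0,1,\ldots,n$. Then, as $n\to\infty$, $$[f(\boldsymbol{M}_n[g])]_{0,0}=\boldsymbol{e}_0^\top f(\boldsymbol{M}_n[g])\,\boldsymbol{e}_0\;\longrightarrow\;\int_\Omega f(g(\boldsymbol{x}))\,w(\boldsymbol{x})\,d\boldsymbol{x}.$$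
   Context: $\Omega\subset\mathbb{R}^d$, and $w:\Omega\to[0,\infty)$ is a weight function normalized so that $\int_\Omega w(\boldsymbol{x})\,d\boldsymbol{x}=1$. $\mathcal{L}_w^2(\Omega)$ is the Hilbert space of (complex-valued) functions, square integrable with respect to $w(\boldsymbol{x})\,d\boldsymbol{x}$ and identified when equal almost everywhere with respect to this measure, with inner product $\langle\phi,\psi\rangle=\int_\Omega\overline{\phi(\boldsymbol{x})}\,\psi(\boldsymbol{x})\,w(\boldsymbol{x})\,d\boldsymbol{x}$. For bounded $g$, the multiplication operator $\mathsf{M}[g]:\mathcal{L}_w^2(\Omega)\to\mathcal{L}_w^2(\Omega)$ is defined almost everywhere pointwise by $(\mathsf{M}[g]\phi)(\boldsymbol{x})=g(\boldsymbol{x})\phi(\boldsymbol{x})$. Its spectral family is $\mathsf{E}(t)=\mathsf{M}[\chi_{\{\boldsymbol{x}:\,g(\boldsymbol{x})\le t\}}]$, where $\chi$ denotes the characteristic function; thus for a closed set $C\subset\mathbb{R}$, $\int_C d\mathsf{E}(t)=\mathsf{M}[\chi_{\{\boldsymbol{x}:\,g(\boldsymbol{x})\in C\}}]$, and this operator is $\mathsf{0}$ exactly when $\int_{\{\boldsymbol{x}:\,g(\boldsymbol{x})\in C\}}w(\boldsymbol{x})\,d\boldsymbol{x}=0$. "Piecewise continuous" is not meant to restrict $f$ to finitely many discontinuities; the restriction on the discontinuities of $f$ is the condition on $\overline{K}$ given in the claim. For a Hermitian matrix $\boldsymbol{A}=\boldsymbol{U}\,\mathrm{diag}(\lambda_0,\ldots,\lambda_n)\,\boldsymbol{U}^*$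 with $\boldsymbol{U}$ unitary, the matrix function is $f(\boldsymbol{A})=\boldsymbol{U}\,\mathrm{diag}(f(\lambda_0),\ldots,f(\lambda_n))\,\boldsymbol{U}^*$. Matrix and vector indices start at $0$, and $\boldsymbol{e}_0$ is the vector with $1$ in component $0$ and $0$ elsewhere. *)

theory Defs
  imports "HOL-Probability.Distribution_Functions" "Jordan_Normal_Form.Schur_Decomposition"
begin

section \<open>The weighted space of square integrable functions\<close>

text \<open>
  Elements of the weighted space are represented by complex-valued functions on the ambient
  space; only the values on the domain \<open>\<Omega>\<close> matter, and equality is equality almost
  everywhere with respect to the measure with density \<open>w\<close>.
\<close>

definition weighted_measure :: "'a::euclidean_space set \<Rightarrow> ('a \<Rightarrow> real) \<Rightarrow> 'a measure" where
  "weighted_measure \<Omega> w = density (lebesgue_on \<Omega>) (\<lambda>x. ennreal (w x))"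

definition L2 :: "'a::euclidean_space set \<Rightarrow> ('a \<Rightarrow> real) \<Rightarrow> ('a \<Rightarrow> complex) set" where
  "L2 \<Omega> w = {\<phi> \<in> borel_measurable (lebesgue_on \<Omega>).
                integrable (lebesgue_on \<Omega>) (\<lambda>x. (cmod (\<phi> x))\<^sup>2 * w x)}"

definition L2_inner ::
    "'a::euclidean_space set \<Rightarrow> ('a \<Rightarrow> real) \<Rightarrow> ('a \<Rightarrow> complex) \<Rightarrow> ('a \<Rightarrow> complex) \<Rightarrow> complex" where
  "L2_inner \<Omega> w \<phi> \<psi> = (LINT x|lebesgue_on \<Omega>. cnj (\<phi> x) * \<psi> x * complex_of_real (w x))"

definition L2_norm ::
    "'a::euclidean_space set \<Rightarrow> ('a \<Rightarrow> real) \<Rightarrow> ('a \<Rightarrow> complex) \<Rightarrow> real" where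
  "L2_norm \<Omega> w \<phi> = sqrt (LINT x|lebesgue_on \<Omega>. (cmod (\<phi> x))\<^sup>2 * w x)"

definition L2_orthonormal_basis ::
    "'a::euclidean_space set \<Rightarrow> ('a \<Rightarrow> real) \<Rightarrow> (nat \<Rightarrow> 'a \<Rightarrow> complex) \<Rightarrow> bool" where
  "L2_orthonormal_basis \<Omega> w \<phi> \<longleftrightarrow>
     (\<forall>i. \<phi> i \<in> L2 \<Omega> w) \<and>
     (\<forall>i j. L2_inner \<Omega> w (\<phi> i) (\<phi> j) = (if i = j then 1 else 0)) \<and>
     (\<forall>\<psi>\<in>L2 \<Omega> w. \<forall>\<epsilon>>0. \<exists>m c. L2_norm \<Omega> w (\<lambda>x. \<psi> x - (\<Sum>i<m. c i * \<phi> i x)) < \<epsilon>)"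

section \<open>Multiplication operators and their spectral families\<close>

definition mult_op :: "('a \<Rightarrow> real) \<Rightarrow> ('a \<Rightarrow> complex) \<Rightarrow> 'a \<Rightarrow> complex" where
  "mult_op g \<phi> = (\<lambda>x. complex_of_real (g x) * \<phi> x)"

definition spectral_family :: "('a \<Rightarrow> real) \<Rightarrow> real \<Rightarrow> ('a \<Rightarrow> complex) \<Rightarrow> 'a \<Rightarrow> complex" where
  "spectral_family g t = mult_op (indicator {x. g x \<le> t})"

text \<open>
  \<open>has_spectral_integral \<Omega> w E C T\<close>: the linear operator \<open>T\<close> is the integral of
  \<open>dE(t)\<close> over the set \<open>C\<close>, in the usual weak sense: \<open>\<langle>\<psi>, T \<psi>\<rangle>\<close> is the mass of \<open>C\<close> under the
  Stieltjes measure \<open>d\<langle>\<psi>, E(t) \<psi>\<rangle>\<close>. By polarization this determines a linear \<open>T\<close> up to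
  equality almost everywhere.
\<close>

definition has_spectral_integral ::
    "'a::euclidean_space set \<Rightarrow> ('a \<Rightarrow> real) \<Rightarrow> (real \<Rightarrow> ('a \<Rightarrow> complex) \<Rightarrow> 'a \<Rightarrow> complex) \<Rightarrow>
     real set \<Rightarrow> (('a \<Rightarrow> complex) \<Rightarrow> 'a \<Rightarrow> complex) \<Rightarrow> bool" where
  "has_spectral_integral \<Omega> w E C T \<longleftrightarrow>
     (\<forall>\<psi>\<in>L2 \<Omega> w. L2_inner \<Omega> w \<psi> (T \<psi>) =
        complex_of_real (measure (interval_measure (\<lambda>t. Re (L2_inner \<Omega> w \<psi> (E t \<psi>)))) C))"

definition zero_op :: "('a \<Rightarrow> complex) \<Rightarrow> 'a \<Rightarrow> complex" where
  "zero_op \<psi> = (\<lambda>x. 0)"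

section \<open>Functions of Hermitian matrices\<close>

text \<open>The matrix does not depend on the chosen diagonalization, so the description is proper
  for every Hermitian matrix.\<close>

definition hermitian_fun :: "(real \<Rightarrow> real) \<Rightarrow> complex mat \<Rightarrow> complex mat" where
  "hermitian_fun f A = (THE B. \<exists>U (ev :: nat \<Rightarrow> real).
     U \<in> carrier_mat (dim_row A) (dim_row A) \<and>
     U * mat_adjoint U = 1\<^sub>m (dim_row A) \<and>
     mat_adjoint U * U = 1\<^sub>m (dim_row A) \<and>
     A = U * mat_diag (dim_row A) (\<lambda>i. complex_of_real (ev i)) * mat_adjoint U \<and>
     B = U * mat_diag (dim_row A) (\<lambda>i. complex_of_real (f (ev i))) * mat_adjoint U)"

definition mult_matrix :: "'a::euclidean_space set \<Rightarrow> ('a \<Rightarrow> real) \<Rightarrow> (nat \<Rightarrow> 'a \<Rightarrow> complex) \<Rightarrow>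
    ('a \<Rightarrow> real) \<Rightarrow> nat \<Rightarrow> complex mat" where
  "mult_matrix \<Omega> w \<phi> g n =
     mat (n + 1) (n + 1) (\<lambda>(i, j). L2_inner \<Omega> w (\<phi> i) (mult_op g (\<phi> j)))"

section \<open>The spectral integral of a multiplication operator\<close>

lemma L2_inner_mult_indicator:
  "L2_inner \<Omega> w \<psi> (mult_op (indicator {x. g x \<in> C}) \<psi>) =
     complex_of_real (LINT x|lebesgue_on \<Omega>. indicator C (g x) * ((cmod (\<psi> x))\<^sup>2 * w x))"
proof -
  have "cnj (\<psi> x) * mult_op (indicator {x. g x \<in> C}) \<psi> x * complex_of_real (w x) =
      complex_of_real (indicator C (g x) * ((cmod (\<psi> x))\<^sup>2 * w x))" for x
    by (auto simp: mult_op_def indicator_def complex_norm_square simp flip: of_real_power)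
  then have "L2_inner \<Omega> w \<psi> (mult_op (indicator {x. g x \<in> C}) \<psi>) =
      (LINT x|lebesgue_on \<Omega>. complex_of_real (indicator C (g x) * ((cmod (\<psi> x))\<^sup>2 * w x)))"
    unfolding L2_inner_def by (intro Bochner_Integration.integral_cong refl)
  then show ?thesis
    by (simp only: integral_complex_of_real)
qed

lemma measure_spectral_family:
  fixes \<Omega> :: "'a::euclidean_space set"
  assumes \<Omega>: "\<Omega> \<in> sets lebesgue" and w: "\<And>x. x \<in> \<Omega> \<Longrightarrow> 0 \<le> w x"
    and g: "g \<in> borel_measurable (lebesgue_on \<Omega>)" and \<psi>: "\<psi> \<in> L2 \<Omega> w" and C: "C \<in> sets borel"
  shows "measure (interval_measure (\<lambda>t. Re (L2_inner \<Omega> w \<psi> (spectral_family g t \<psi>)))) C =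
     (LINT x|lebesgue_on \<Omega>. indicator C (g x) * ((cmod (\<psi> x))\<^sup>2 * w x))"
proof -
  define h where "h = (\<lambda>x. (cmod (\<psi> x))\<^sup>2 * w x)"
  have h: "integrable (lebesgue_on \<Omega>) h" using \<psi> by (simp add: L2_def h_def)
  have hm: "h \<in> borel_measurable (lebesgue_on \<Omega>)" using h by simp
  have h0: "AE x in lebesgue_on \<Omega>. 0 \<le> h x"
    using w by (intro AE_I2) (auto simp: h_def)
  define M where "M = density (lebesgue_on \<Omega>) (\<lambda>x. ennreal (h x))"
  define D where "D = distr M borel g"
  have gM: "g \<in> measurable M borel" using g by (simp add: M_def)
  have fM: "finite_measure M"
  proof
    have "emeasure M (space M) = (\<integral>\<^sup>+x. ennreal (h x) \<partial>lebesgue_on \<Omega>)"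
      using hm
      unfolding M_def
      by (subst emeasure_density) (auto intro!: nn_integral_cong)
    also have "\<dots> < \<infinity>" using h h0 by (simp add: nn_integral_eq_integral)
    finally show "emeasure M (space M) \<noteq> \<infinity>" by simp
  qed
  have D: "finite_borel_measure D"
  proof -
    interpret M: finite_measure M by (rule fM)
    interpret D: finite_measure D unfolding D_def by (rule M.finite_measure_distr[OF gM])
    show ?thesis by unfold_locales (simp add: D_def)
  qed
  interpret D: finite_borel_measure D by (rule D)
  have mD: "measure D B = (LINT x|lebesgue_on \<Omega>. indicator B (g x) * h x)"
    if B: "B \<in> sets borel" for B
  proof -
    have sM: "g -` B \<inter> space M \<in> sets (lebesgue_on \<Omega>)"
      using measurable_sets[OF g B] by (simp add: M_def)
    have "emeasure D B = emeasure M (g -` B \<inter> space M)"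
      using gM B by (simp add: D_def emeasure_distr)
    also have "\<dots> = (\<integral>\<^sup>+x. ennreal (h x) * indicator (g -` B \<inter> space M) x \<partial>lebesgue_on \<Omega>)"
      using hm sM by (simp add: M_def emeasure_density)
    also have "\<dots> = (\<integral>\<^sup>+x. ennreal (indicator B (g x) * h x) \<partial>lebesgue_on \<Omega>)"
      by (intro nn_integral_cong) (auto simp: M_def indicator_def)
    finally have 1: "emeasure D B = (\<integral>\<^sup>+x. ennreal (indicator B (g x) * h x) \<partial>lebesgue_on \<Omega>)" .
    have m: "(\<lambda>x. indicator B (g x) * h x) \<in> borel_measurable (lebesgue_on \<Omega>)"
      using B g hm by measurable
    have "(LINT x|lebesgue_on \<Omega>. indicator B (g x) * h x) =
        enn2real (\<integral>\<^sup>+x. ennreal (indicator B (g x) * h x) \<partial>lebesgue_on \<Omega>)"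
      using m h0 by (intro integral_eq_nn_integral) (auto simp: indicator_def)
    then show ?thesis using 1 by (simp add: measure_def)
  qed
  have F: "(\<lambda>t. Re (L2_inner \<Omega> w \<psi> (spectral_family g t \<psi>))) = cdf D"
  proof
    fix t
    have "L2_inner \<Omega> w \<psi> (spectral_family g t \<psi>) = complex_of_real (measure D {..t})"
      using L2_inner_mult_indicator[of \<Omega> w \<psi> g "{..t}"] mD[of "{..t}"]
      by (simp add: spectral_family_def h_def)
    then show "Re (L2_inner \<Omega> w \<psi> (spectral_family g t \<psi>)) = cdf D t"
      by (simp add: cdf_def)
  qed
  have "interval_measure (cdf D) = D"
  proof (rule cdf_unique')
    show "finite_borel_measure (interval_measure (cdf D))"
      by (rule finite_borel_measure_interval_measure[where m = "measure D (space D)"])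
        (auto intro: D.cdf_nondecreasing D.cdf_is_right_cont D.cdf_lim_at_bot D.cdf_lim_at_top)
    show "cdf (interval_measure (cdf D)) = cdf D"
      by (rule cdf_interval_measure)
        (auto intro: D.cdf_nondecreasing D.cdf_is_right_cont D.cdf_lim_at_bot)
  qed (rule D)
  then show ?thesis using mD[OF C] by (simp add: F h_def)
qed

lemma has_spectral_integral_mult_op:
  assumes "\<Omega> \<in> sets lebesgue" and "\<And>x. x \<in> \<Omega> \<Longrightarrow> 0 \<le> w x"
    and "g \<in> borel_measurable (lebesgue_on \<Omega>)" and "C \<in> sets borel"
  shows "has_spectral_integral \<Omega> w (spectral_family g) C (mult_op (indicator {x. g x \<in> C}))"
  unfolding has_spectral_integral_def
  using L2_inner_mult_indicator[of \<Omega> w _ g C] measure_spectral_family[OF assms(1-3) _ assms(4)]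
  by simp

lemma has_spectral_integral_zero_iff:
  assumes \<Omega>: "\<Omega> \<in> sets lebesgue" and w: "\<And>x. x \<in> \<Omega> \<Longrightarrow> 0 \<le> w x"
    and iw: "integrable (lebesgue_on \<Omega>) w"
    and g: "g \<in> borel_measurable (lebesgue_on \<Omega>)" and C: "C \<in> sets borel"
  shows "has_spectral_integral \<Omega> w (spectral_family g) C zero_op \<longleftrightarrow>
     (LINT x|lebesgue_on \<Omega>. indicator C (g x) * w x) = 0"
proof
  assume *: "has_spectral_integral \<Omega> w (spectral_family g) C zero_op"
  have 1: "(\<lambda>x. 1) \<in> L2 \<Omega> w" using iw by (simp add: L2_def)
  have "L2_inner \<Omega> w (\<lambda>x. 1) (zero_op (\<lambda>x. 1)) = 0" by (simp add: L2_inner_def zero_op_def)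
  then show "(LINT x|lebesgue_on \<Omega>. indicator C (g x) * w x) = 0"
    using * 1 measure_spectral_family[OF \<Omega> w g 1 C] by (auto simp: has_spectral_integral_def)
next
  assume 0: "(LINT x|lebesgue_on \<Omega>. indicator C (g x) * w x) = 0"
  have m: "(\<lambda>x. indicator C (g x) * w x) \<in> borel_measurable (lebesgue_on \<Omega>)"
    using C g iw by measurable
  have int: "integrable (lebesgue_on \<Omega>) (\<lambda>x. indicator C (g x) * w x)"
    by (rule Bochner_Integration.integrable_bound[OF iw m]) (auto simp: indicator_def)
  have "AE x in lebesgue_on \<Omega>. 0 \<le> indicator C (g x) * w x"
    using w by (intro AE_I2) (simp add: indicator_def)
  then have "AE x in lebesgue_on \<Omega>. indicator C (g x) * w x = 0"
    using 0 integral_nonneg_eq_0_iff_AE[OF int] by blast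
  then have "AE x in lebesgue_on \<Omega>. indicator C (g x) * ((cmod (\<psi> x))\<^sup>2 * w x) = 0"
    for \<psi> :: "'a \<Rightarrow> complex"
    by eventually_elim auto
  then have "(LINT x|lebesgue_on \<Omega>. indicator C (g x) * ((cmod (\<psi> x))\<^sup>2 * w x)) = 0"
    for \<psi> :: "'a \<Rightarrow> complex"
    by (rule integral_eq_zero_AE)
  then show "has_spectral_integral \<Omega> w (spectral_family g) C zero_op"
    using measure_spectral_family[OF \<Omega> w g _ C]
    by (simp add: has_spectral_integral_def L2_inner_def zero_op_def)
qed

end

theory Submission
  imports Defs
begin

text \<open>
  Diagonalizing \<open>M\<^sub>n[g] = U diag(\<lambda>\<^sub>j) U\<^sup>*\<close> gives \<open>[f(M\<^sub>n[g])]\<^sub>0\<^sub>0 = \<Sum>\<^sub>j |U\<^sub>0\<^sub>j|\<^sup>2 f(\<lambda>\<^sub>j)\<close>, a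
  quadrature rule with positive weights of total mass 1 and nodes in the convex hull of the range
  of \<open>g\<close>. The matrix \<open>M\<^sub>n[g]\<close> represents \<open>P\<^sub>n g P\<^sub>n\<close>, where \<open>P\<^sub>n\<close> is the projection onto the span
  of \<open>\<phi>\<^sub>0, \<dots>, \<phi>\<^sub>n\<close>, and \<open>(P\<^sub>n g)\<^sup>k 1\<close> tends to \<open>g\<^sup>k\<close> in mean square by induction on \<open>k\<close>; so all
  moments of the quadrature rules converge to those of the distribution of \<open>g\<close>. By the Weierstrass
  theorem the rules converge for continuous functions. Cutting \<open>f\<close> off near the closure of its
  discontinuities, which has measure zero under the distribution of \<open>g\<close>, reduces the claim to that
  case.
\<close>

section \<open>Unitary diagonalization of Hermitian matrices\<close>

unbundle no vec_syntax

lemma mat_adjoint_conv: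
  "mat_adjoint A = mat (dim_col A) (dim_row A) (\<lambda>(i, j). conjugate (A $$ (j, i)))"
  by (rule eq_matI) (auto simp: mat_adjoint_def mat_of_rows_def)

lemma mat_adjoint_carrier [simp, intro]:
  "A \<in> carrier_mat n m \<Longrightarrow> mat_adjoint A \<in> carrier_mat m n"
  by (auto simp: mat_adjoint_conv)

lemma mat_adjoint_index [simp]:
  "i < dim_col A \<Longrightarrow> j < dim_row A \<Longrightarrow> mat_adjoint A $$ (i, j) = conjugate (A $$ (j, i))"
  by (simp add: mat_adjoint_conv)

lemma mat_adjoint_dim [simp]:
  "dim_row (mat_adjoint A) = dim_col A" "dim_col (mat_adjoint A) = dim_row A"
  by (auto simp: mat_adjoint_conv)

lemma mat_adjoint_adjoint [simp]: "mat_adjoint (mat_adjoint A) = A"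
  by (rule eq_matI) auto

lemma index_mult_mat_sum:
  assumes "A \<in> carrier_mat n m" "B \<in> carrier_mat m k" "i < n" "j < k"
  shows "(A * B) $$ (i, j) = (\<Sum>l<m. A $$ (i, l) * B $$ (l, j))"
  using assms by (auto simp: scalar_prod_def lessThan_atLeast0)

lemma mat_adjoint_mult:
  fixes A B :: "complex mat"
  assumes "A \<in> carrier_mat n m" "B \<in> carrier_mat m k"
  shows "mat_adjoint (A * B) = mat_adjoint B * mat_adjoint A"
  using assms by (intro eq_matI) (auto simp: scalar_prod_def mult.commute)

text \<open>Both products are required, matching the conditions that \<open>hermitian_fun\<close>
  puts on its diagonalizing matrix.\<close>

definition unitary_mat :: "nat \<Rightarrow> complex mat \<Rightarrow> bool" where
  "unitary_mat n U \<longleftrightarrow>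
     U \<in> carrier_mat n n \<and> U * mat_adjoint U = 1\<^sub>m n \<and> mat_adjoint U * U = 1\<^sub>m n"

lemma unitary_matD:
  assumes "unitary_mat n U"
  shows "U \<in> carrier_mat n n" "U * mat_adjoint U = 1\<^sub>m n" "mat_adjoint U * U = 1\<^sub>m n"
  using assms by (auto simp: unitary_mat_def)

lemma unitary_mat_mult:
  assumes U: "unitary_mat n U" and V: "unitary_mat n V"
  shows "unitary_mat n (U * V)"
proof -
  note U = unitary_matD[OF U] and V = unitary_matD[OF V]
  have "U * V * (mat_adjoint V * mat_adjoint U) = U * (V * mat_adjoint V) * mat_adjoint U"
    using U(1) V(1) by (simp add: assoc_mult_mat[where ?n\<^sub>1 = n and ?n\<^sub>2 = n and ?n\<^sub>3 = n and ?n\<^sub>4 = n]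
        mult_carrier_mat[where n = n])
  moreover have "mat_adjoint V * mat_adjoint U * (U * V) =
      mat_adjoint V * (mat_adjoint U * U) * V"
    using U(1) V(1) by (simp add: assoc_mult_mat[where ?n\<^sub>1 = n and ?n\<^sub>2 = n and ?n\<^sub>3 = n and ?n\<^sub>4 = n]
        mult_carrier_mat[where n = n])
  ultimately show ?thesis
    using U V by (auto simp: unitary_mat_def mat_adjoint_mult[OF U(1) V(1)])
qed

text \<open>Complete \<open>v\<close> to a basis, orthogonalize by Gram-Schmidt, which keeps the
  first vector, and normalize. The scalar \<open>c\<close> is the normalization of
  \<open>v\<close>.\<close>

lemma unitary_first_col:
  fixes v :: "complex vec"
  assumes v: "v \<in> carrier_vec n" and v0: "v \<noteq> 0\<^sub>v n" and n: "n \<noteq> 0"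
  obtains W c where "unitary_mat n W" "col W 0 = c \<cdot>\<^sub>v v"
proof -
  interpret cof_vec_space n "TYPE(complex)" .
  define b where "b = basis_completion v"
  define ws where "ws = gram_schmidt n b"
  from basis_completion[OF v v0, folded b_def]
  have b: "distinct b" "\<not> lin_dep (set b)" "set b \<subseteq> carrier_vec n" "hd b = v" "length b = n"
    by auto
  from b n obtain vs where bv: "b = v # vs" by (cases b) auto
  have ws: "set ws \<subseteq> carrier_vec n" "corthogonal ws" "length ws = n"
    using gram_schmidt_result[OF b(3,1,2) refl, folded ws_def] b(5) by auto
  have ws0: "ws ! 0 = v"
    using gram_schmidt_hd[OF v, of vs, folded bv, folded ws_def] ws(3) n
    by (subst hd_conv_nth[symmetric]) auto
  have wsi: "ws ! i \<in> carrier_vec n" if "i < n" for i using that ws by auto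
  define s where "s i = (\<Sum>k<n. (cmod (ws ! i $ k))\<^sup>2)" for i
  have dot: "ws ! i \<bullet>c ws ! j = (\<Sum>k<n. ws ! i $ k * cnj (ws ! j $ k))" if "i < n" "j < n" for i j
    using wsi[OF that(1)] wsi[OF that(2)] by (simp add: scalar_prod_def lessThan_atLeast0)
  have s: "ws ! i \<bullet>c ws ! i = complex_of_real (s i)" if "i < n" for i
    by (simp add: dot[OF that that] s_def flip: complex_norm_square)
  have sp: "s i > 0" if "i < n" for i
  proof -
    \<comment> \<open>The notion \<open>corthogonal\<close> also says that no vector is orthogonal
      to itself, which excludes zero vectors.\<close>
    have "s i \<noteq> 0" using corthogonalD[OF ws(2), of i i] s[OF that] that ws(3) by auto
    moreover have "s i \<ge> 0" by (auto simp: s_def intro: sum_nonneg)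
    ultimately show ?thesis by simp
  qed
  define W where "W = mat n n (\<lambda>(k, i). complex_of_real (1 / sqrt (s i)) * ws ! i $ k)"
  have W: "W \<in> carrier_mat n n" by (simp add: W_def)
  have "mat_adjoint W * W = 1\<^sub>m n"
  proof (rule eq_matI)
    fix i j assume "i < dim_row (1\<^sub>m n :: complex mat)" "j < dim_col (1\<^sub>m n :: complex mat)"
    then have ij: "i < n" "j < n" by auto
    have "(mat_adjoint W * W) $$ (i, j) = (\<Sum>k<n. mat_adjoint W $$ (i, k) * W $$ (k, j))"
      by (rule index_mult_mat_sum) (use W ij in auto)
    also have "\<dots> = (\<Sum>k<n. complex_of_real (1 / (sqrt (s i) * sqrt (s j))) *
        (ws ! j $ k * cnj (ws ! i $ k)))"
      using W ij by (intro sum.cong) (auto simp: W_def)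
    also have "\<dots> = complex_of_real (1 / (sqrt (s i) * sqrt (s j))) * (ws ! j \<bullet>c ws ! i)"
      by (simp add: dot ij sum_distrib_left)
    also have "\<dots> = (if i = j then 1 else 0)"
    proof (cases "i = j")
      case True
      have "sqrt (s j) * sqrt (s j) = s j" using sp[OF ij(2)] by simp
      then show ?thesis using True sp[OF ij(2)] by (simp only: s[OF ij(2)] flip: of_real_mult) simp
    next
      case False
      then show ?thesis using corthogonalD[OF ws(2), of j i] ij ws(3) by simp
    qed
    finally show "(mat_adjoint W * W) $$ (i, j) = 1\<^sub>m n $$ (i, j)" using ij by simp
  qed (use W in auto)
  \<comment> \<open>For square matrices a left inverse is also a right inverse.\<close>
  then have "unitary_mat n W"
    using W mat_mult_left_right_inverse[of "mat_adjoint W" n W] by (auto simp: unitary_mat_def)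
  moreover have "col W 0 = complex_of_real (1 / sqrt (s 0)) \<cdot>\<^sub>v v"
    using n v W by (intro eq_vecI) (auto simp: W_def ws0)
  ultimately show ?thesis by (rule that)
qed

lemma complex_eigenvector_exists:
  fixes A :: "complex mat"
  assumes A: "A \<in> carrier_mat n n" and n: "n \<noteq> 0"
  obtains v e where "v \<in> carrier_vec n" "v \<noteq> 0\<^sub>v n" "A *\<^sub>v v = e \<cdot>\<^sub>v v"
proof -
  have "degree (char_poly A) = n" using degree_monic_char_poly[OF A] by simp
  then have "\<not> constant (poly (char_poly A))" using n by (simp add: constant_degree)
  then obtain e where "poly (char_poly A) e = 0"
    using fundamental_theorem_of_algebra by blast
  then have "eigenvalue A e" using eigenvalue_root_char_poly[OF A] by simp
  then show ?thesis using that A by (auto simp: eigenvalue_def eigenvector_def)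
qed

text \<open>Deflation by induction on the dimension. In a unitary basis that starts with an
  eigenvector, the first column vanishes below the corner, by symmetry so does the rest of the first
  row, and the remaining block is Hermitian and smaller.\<close>

theorem hermitian_diagonalization:
  fixes A :: "complex mat"
  assumes "A \<in> carrier_mat n n" "mat_adjoint A = A"
  obtains U and ev :: "nat \<Rightarrow> real" where "unitary_mat n U"
    "A = U * mat_diag n (\<lambda>i. complex_of_real (ev i)) * mat_adjoint U"
proof -
  have "\<exists>U (ev :: nat \<Rightarrow> real). unitary_mat n U \<and>
      A = U * mat_diag n (\<lambda>i. complex_of_real (ev i)) * mat_adjoint U"
    using assms
  proof (induction n arbitrary: A)
    case 0
    then have "unitary_mat 0 (1\<^sub>m 0)" by (auto simp: unitary_mat_def)
    moreover have "A = 1\<^sub>m 0 * mat_diag 0 (\<lambda>i. complex_of_real ((\<lambda>_. 0) i)) * mat_adjoint (1\<^sub>m 0)"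
      using 0 by (intro eq_matI) auto
    ultimately show ?case by (intro exI[of _ "1\<^sub>m 0"] exI[of _ "\<lambda>_. 0"] conjI)
  next
    case (Suc n)
    let ?N = "Suc n"
    note A = Suc.prems(1) and herm = Suc.prems(2)
    note assoc = assoc_mult_mat[where ?n\<^sub>1 = ?N and ?n\<^sub>2 = ?N and ?n\<^sub>3 = ?N and ?n\<^sub>4 = ?N]
    obtain v e where v: "v \<in> carrier_vec ?N" "v \<noteq> 0\<^sub>v ?N" "A *\<^sub>v v = e \<cdot>\<^sub>v v"
      using complex_eigenvector_exists[OF A] by auto
    obtain W c where W: "unitary_mat ?N W" and Wv: "col W 0 = c \<cdot>\<^sub>v v"
      using unitary_first_col[OF v(1,2)] by auto
    note W = W unitary_matD[OF W]
    define A' where "A' = mat_adjoint W * (A * W)"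
    have A': "A' \<in> carrier_mat ?N ?N" using A W by (auto simp: A'_def)
    have herm': "mat_adjoint A' = A'"
    proof -
      have "mat_adjoint A' = mat_adjoint (A * W) * W"
        unfolding A'_def
        by (subst mat_adjoint_mult[where n = ?N and m = ?N and k = ?N]) (use A W in auto)
      also have "\<dots> = mat_adjoint W * A * W"
        using A W herm by (simp add: mat_adjoint_mult[where n = ?N and m = ?N and k = ?N])
      finally show ?thesis using A W(2) by (simp add: A'_def assoc)
    qed
    have AW: "A * W = W * A'"
    proof -
      have "W * A' = (W * mat_adjoint W) * (A * W)"
        unfolding A'_def using A W(2) by (intro assoc[symmetric]) auto
      then show ?thesis using A W by simp
    qed
    have AA': "A = W * A' * mat_adjoint W"
    proof -
      have "W * A' * mat_adjoint W = A * (W * mat_adjoint W)"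
        using A W(2) by (simp add: assoc flip: AW)
      then show ?thesis using A W by simp
    qed
    \<comment> \<open>\<open>A\<close> scales the first column of \<open>W\<close> by
      \<open>e\<close>, and \<open>mat_adjoint W\<close> maps that column to the first unit
      vector.\<close>
    have "col A' 0 = e \<cdot>\<^sub>v unit_vec ?N 0"
    proof -
      have "col A' 0 = mat_adjoint W *\<^sub>v (A *\<^sub>v col W 0)"
        unfolding A'_def
        using col_mult2[of "mat_adjoint W" ?N ?N "A * W" ?N 0] col_mult2[of A ?N ?N W ?N 0] A W(2)
        by auto
      also have "A *\<^sub>v col W 0 = e \<cdot>\<^sub>v col W 0"
        using A v by (simp add: Wv mult_mat_vec smult_smult_assoc mult.commute)
      also have "mat_adjoint W *\<^sub>v (e \<cdot>\<^sub>v col W 0) = e \<cdot>\<^sub>v (mat_adjoint W *\<^sub>v col W 0)"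
        using W(2) by (intro mult_mat_vec[of _ ?N ?N]) (auto intro: carrier_vecI)
      also have "mat_adjoint W *\<^sub>v col W 0 = col (mat_adjoint W * W) 0"
        using W(2) by (subst col_mult2[where n = ?N]) auto
      finally show ?thesis using W by simp
    qed
    note col0' = this
    have col0: "A' $$ (i, 0) = (if i = 0 then e else 0)" if "i < ?N" for i
      using that A' arg_cong[OF col0', of "\<lambda>v. v $ i"] by simp
    have adj: "A' $$ (i, j) = cnj (A' $$ (j, i))" if "i < ?N" "j < ?N" for i j
      using that A' mat_adjoint_index[of i A' j] by (simp add: herm')
    have row0: "A' $$ (0, j) = (if j = 0 then e else 0)" if "j < ?N" for j
      using adj[of 0 j] col0[of j] col0[of 0] that by (cases "j = 0") auto
    \<comment> \<open>The corner entry of a Hermitian matrix is its own conjugate, so the eigenvalue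
      is real.\<close>
    have e: "e = complex_of_real (Re e)"
      using adj[of 0 0] col0[of 0] by (simp add: complex_eq_iff)
    define B where "B = mat n n (\<lambda>(i, j). A' $$ (Suc i, Suc j))"
    have B: "B \<in> carrier_mat n n" by (simp add: B_def)
    have "mat_adjoint B = B"
      by (intro eq_matI) (auto simp: B_def intro: adj[symmetric])
    with Suc.IH[OF B] obtain V and ev :: "nat \<Rightarrow> real" where V: "unitary_mat n V"
      and BV: "B = V * mat_diag n (\<lambda>i. complex_of_real (ev i)) * mat_adjoint V" by blast
    note V = unitary_matD[OF V]
    define one where "one = (1\<^sub>m 1 :: complex mat)"
    have one: "one \<in> carrier_mat 1 1" "mat_adjoint one = one"
      by (auto simp: one_def intro!: eq_matI)
    have one1: "one * one = one" by (simp add: one_def)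
    \<comment> \<open>Block diagonal matrices with a leading block of size 1. Products and adjoints
      act blockwise, so the diagonalization of \<open>B\<close> lifts to one of
      \<open>A'\<close>.\<close>
    define FB where "FB C D = four_block_mat C (0\<^sub>m 1 n) (0\<^sub>m n 1) D" for C D :: "complex mat"
    have FBc: "FB C D \<in> carrier_mat ?N ?N" if "C \<in> carrier_mat 1 1" "D \<in> carrier_mat n n" for C D
      using four_block_carrier_mat[OF that] by (simp add: FB_def)
    have FBm: "FB C D * FB C' D' = FB (C * C') (D * D')"
      if "C \<in> carrier_mat 1 1" "D \<in> carrier_mat n n" "C' \<in> carrier_mat 1 1" "D' \<in> carrier_mat n n"
      for C C' D D'
      unfolding FB_def using that
      by (subst mult_four_block_mat[OF that(1) _ _ that(2) that(3) _ _ that(4)]) auto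
    have FBa: "mat_adjoint (FB C D) = FB (mat_adjoint C) (mat_adjoint D)"
      if "C \<in> carrier_mat 1 1" "D \<in> carrier_mat n n" for C D
      unfolding FB_def using that by (intro eq_matI) auto
    have FB1: "FB one (1\<^sub>m n) = 1\<^sub>m ?N" by (simp add: FB_def one_def)
    define Z where "Z = FB one V"
    have "unitary_mat ?N Z"
      using V one FBc[OF one(1) V(1)] FB1 one1 by (simp add: unitary_mat_def Z_def FBa FBm)
    then have WZ: "unitary_mat ?N (W * Z)" by (intro unitary_mat_mult W)
    have Z: "Z \<in> carrier_mat ?N ?N" using \<open>unitary_mat ?N Z\<close> by (rule unitary_matD)
    \<comment> \<open>The split-off eigenvalue gets index 0 and the eigenvalues of \<open>B\<close>
      move up by one.\<close>
    define ev' where "ev' = case_nat (Re e) ev"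
    define D where "D = mat_diag ?N (\<lambda>i. complex_of_real (ev' i))"
    define E where "E = mat 1 1 (\<lambda>_. e)"
    have E: "E \<in> carrier_mat 1 1" by (simp add: E_def)
    have "D = FB E (mat_diag n (\<lambda>i. complex_of_real (ev i)))"
      unfolding D_def FB_def E_def mat_diag_def ev'_def
      by (intro eq_matI) (use e in \<open>auto split: nat.splits\<close>)
    then have "Z * D * mat_adjoint Z = FB (one * E * one) B"
      using V(1) one E
      by (simp add: Z_def FBa FBm BV mult_carrier_mat[where n = 1] mult_carrier_mat[where n = n])
    also have "\<dots> = A'"
    proof -
      have "one * E * one = E" using E by (simp add: one_def)
      then show ?thesis
        using A' row0 col0
        by (intro eq_matI) (auto simp: FB_def E_def B_def gr0_conv_Suc less_Suc_eq_0_disj)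
    qed
    finally have A'Z: "A' = Z * D * mat_adjoint Z" ..
    have D: "D \<in> carrier_mat ?N ?N" by (simp add: D_def)
    have "A = (W * Z) * D * mat_adjoint (W * Z)"
      unfolding AA' A'Z mat_adjoint_mult[OF W(2) Z] using W(2) Z D
      by (simp add: assoc mult_carrier_mat[where n = ?N])
    then show ?case using WZ unfolding D_def by blast
  qed
  then show ?thesis using that by blast
qed


text \<open>Justifies the definite description in \<open>hermitian_fun\<close>. The transition
  matrix between two diagonalizations couples only equal eigenvalues, so it still intertwines the
  diagonal matrices after \<open>f\<close> is applied to their entries.\<close>

lemma hermitian_fun_diagonalized:
  assumes U: "unitary_mat n U"
    and A: "A = U * mat_diag n (\<lambda>i. complex_of_real (ev i)) * mat_adjoint U"
  shows "hermitian_fun f A = U * mat_diag n (\<lambda>i. complex_of_real (f (ev i))) * mat_adjoint U"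
proof -
  note Uc = unitary_matD[OF U]
  have dim: "dim_row A = n" using Uc(1) by (simp add: A)
  have unique: "V * mat_diag n (\<lambda>i. complex_of_real (f (d i))) * mat_adjoint V =
      U * mat_diag n (\<lambda>i. complex_of_real (f (ev i))) * mat_adjoint U"
    if V: "unitary_mat n V" and AV: "A = V * mat_diag n (\<lambda>i. complex_of_real (d i)) * mat_adjoint V"
    for V and d :: "nat \<Rightarrow> real"
  proof -
    note Vc = unitary_matD[OF V]
    note assoc = assoc_mult_mat[where ?n\<^sub>1 = n and ?n\<^sub>2 = n and ?n\<^sub>3 = n and ?n\<^sub>4 = n]
      mult_carrier_mat[where n = n]
    define W where "W = mat_adjoint V * U"
    have W: "W \<in> carrier_mat n n" using Uc(1) Vc(1) by (simp add: W_def mult_carrier_mat[where n = n])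
    let ?D = "\<lambda>d. mat_diag n (\<lambda>i. complex_of_real (d i))"
    have "mat_adjoint V * A * U = (mat_adjoint V * V) * ?D d * W"
      unfolding AV W_def using Uc(1) Vc(1) by (simp add: assoc)
    moreover have "mat_adjoint V * A * U = W * ?D ev * (mat_adjoint U * U)"
      unfolding A W_def using Uc(1) Vc(1) by (simp add: assoc)
    ultimately have DW: "?D d * W = W * ?D ev"
      using W by (simp add: Uc Vc mult_carrier_mat[where n = n]
        right_mult_one_mat[where nr = n] left_mult_one_mat[where nc = n])
    have *: "complex_of_real (d i) * W $$ (i, j) = W $$ (i, j) * complex_of_real (ev j)"
      if "i < n" "j < n" for i j
    proof -
      have "(?D d * W) $$ (i, j) = (W * ?D ev) $$ (i, j)" by (simp only: DW)
      then show ?thesis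
        using that by (simp only: mat_diag_mult_left[OF W] mat_diag_mult_right[OF W] index_mat split)
    qed
    \<comment> \<open>Comparing entries of the intertwining relation: a nonzero entry of
      \<open>W\<close> forces equal eigenvalues, hence equal values of \<open>f\<close>.\<close>
    have disj: "d i = ev j \<or> W $$ (i, j) = 0" if "i < n" "j < n" for i j
    proof -
      have "W $$ (i, j) * (complex_of_real (d i) - complex_of_real (ev j)) = 0"
        using *[OF that] by (simp only: right_diff_distrib) (simp only: mult.commute diff_self)
      then show ?thesis by auto
    qed
    have **: "complex_of_real (f (d i)) * W $$ (i, j) = W $$ (i, j) * complex_of_real (f (ev j))"
      if "i < n" "j < n" for i j
      using disj[OF that] by auto
    have "?D (\<lambda>i. f (d i)) * W = W * ?D (\<lambda>i. f (ev i))"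
      unfolding mat_diag_mult_left[OF W] mat_diag_mult_right[OF W]
      by (intro cong_mat) (simp_all add: **)
    then have eq: "V * (?D (\<lambda>i. f (d i)) * W) * mat_adjoint U = V * (W * ?D (\<lambda>i. f (ev i))) * mat_adjoint U"
      by simp
    have "V * (?D (\<lambda>i. f (d i)) * W) * mat_adjoint U =
        V * ?D (\<lambda>i. f (d i)) * mat_adjoint V * (U * mat_adjoint U)"
      unfolding W_def using Uc(1) Vc(1) by (simp add: assoc)
    moreover have "V * (W * ?D (\<lambda>i. f (ev i))) * mat_adjoint U =
        (V * mat_adjoint V) * U * ?D (\<lambda>i. f (ev i)) * mat_adjoint U"
      unfolding W_def using Uc(1) Vc(1) by (simp add: assoc)
    ultimately show ?thesis
      using eq Uc Vc by (simp add: mult_carrier_mat[where n = n])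
  qed
  show ?thesis
    unfolding hermitian_fun_def dim
  proof (rule the_equality)
    show "\<exists>V d. V \<in> carrier_mat n n \<and> V * mat_adjoint V = 1\<^sub>m n \<and> mat_adjoint V * V = 1\<^sub>m n \<and>
        A = V * mat_diag n (\<lambda>i. complex_of_real (d i)) * mat_adjoint V \<and>
        U * mat_diag n (\<lambda>i. complex_of_real (f (ev i))) * mat_adjoint U =
          V * mat_diag n (\<lambda>i. complex_of_real (f (d i))) * mat_adjoint V"
      by (rule exI[of _ U], rule exI[of _ ev]) (intro conjI Uc A refl)
  next
    fix B
    assume "\<exists>V (d :: nat \<Rightarrow> real). V \<in> carrier_mat n n \<and> V * mat_adjoint V = 1\<^sub>m n \<and>
        mat_adjoint V * V = 1\<^sub>m n \<and>
        A = V * mat_diag n (\<lambda>i. complex_of_real (d i)) * mat_adjoint V \<and>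
        B = V * mat_diag n (\<lambda>i. complex_of_real (f (d i))) * mat_adjoint V"
    then obtain V and d :: "nat \<Rightarrow> real" where V: "unitary_mat n V"
      and AV: "A = V * mat_diag n (\<lambda>i. complex_of_real (d i)) * mat_adjoint V"
      and BV: "B = V * mat_diag n (\<lambda>i. complex_of_real (f (d i))) * mat_adjoint V"
      unfolding unitary_mat_def by blast
    show "B = U * mat_diag n (\<lambda>i. complex_of_real (f (ev i))) * mat_adjoint U"
      unfolding BV by (rule unique[OF V AV])
  qed
qed

text \<open>For \<open>i = l = 0\<close> the terms are \<open>d j\<close> weighted by the squared
  moduli of the first row of \<open>U\<close>, which is the quadrature sum.\<close>

lemma index_diagonalized:
  fixes U :: "complex mat"
  assumes "U \<in> carrier_mat n n" "i < n" "l < n"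
  shows "(U * mat_diag n d * mat_adjoint U) $$ (i, l) = (\<Sum>j<n. U $$ (i, j) * d j * cnj (U $$ (l, j)))"
proof -
  have c: "U * mat_diag n d \<in> carrier_mat n n" using assms by (simp add: mult_carrier_mat[where n = n])
  have "(U * mat_diag n d * mat_adjoint U) $$ (i, l) =
      (\<Sum>j<n. (U * mat_diag n d) $$ (i, j) * mat_adjoint U $$ (j, l))"
    by (rule index_mult_mat_sum[OF c]) (use assms in auto)
  then show ?thesis using assms by (simp add: mat_diag_mult_right)
qed

section \<open>Square integrable functions and orthonormal sequences\<close>

text \<open>The weight is absorbed into the measure \<open>M\<close>, so the Hilbert space arguments
  below carry no density factor.\<close>

definition sq_integrable :: "'a measure \<Rightarrow> ('a \<Rightarrow> complex) \<Rightarrow> bool" where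
  "sq_integrable M \<phi> \<longleftrightarrow> \<phi> \<in> borel_measurable M \<and> integrable M (\<lambda>x. (cmod (\<phi> x))\<^sup>2)"

definition ip :: "'a measure \<Rightarrow> ('a \<Rightarrow> complex) \<Rightarrow> ('a \<Rightarrow> complex) \<Rightarrow> complex" where
  "ip M \<phi> \<psi> = (LINT x|M. cnj (\<phi> x) * \<psi> x)"

definition nsq :: "'a measure \<Rightarrow> ('a \<Rightarrow> complex) \<Rightarrow> real" where
  "nsq M \<phi> = (LINT x|M. (cmod (\<phi> x))\<^sup>2)"

lemma sq_integrable_measurable: "sq_integrable M \<phi> \<Longrightarrow> \<phi> \<in> borel_measurable M"
  by (simp add: sq_integrable_def)

lemma nsq_nonneg: "0 \<le> nsq M \<phi>"
  by (simp add: nsq_def)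

lemma ip_self: "ip M \<phi> \<phi> = complex_of_real (nsq M \<phi>)"
proof -
  have "(\<lambda>x. cnj (\<phi> x) * \<phi> x) = (\<lambda>x. complex_of_real ((cmod (\<phi> x))\<^sup>2))"
    by (simp only: complex_norm_square mult.commute)
  then show ?thesis by (simp only: ip_def nsq_def integral_complex_of_real)
qed

lemma ip_commute: "ip M \<psi> \<phi> = cnj (ip M \<phi> \<psi>)"
proof -
  have "cnj (ip M \<phi> \<psi>) = (LINT x|M. cnj (cnj (\<phi> x) * \<psi> x))"
    unfolding ip_def by (rule Bochner_Integration.integral_cnj[symmetric])
  then show ?thesis by (simp add: ip_def mult.commute)
qed

lemma sq_integrable_bounded_mult:
  assumes \<phi>: "sq_integrable M \<phi>" and g: "g \<in> borel_measurable M"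
    and bd: "\<And>x. x \<in> space M \<Longrightarrow> \<bar>g x\<bar> \<le> G"
  shows "sq_integrable M (\<lambda>x. complex_of_real (g x) * \<phi> x)"
    and "nsq M (\<lambda>x. complex_of_real (g x) * \<phi> x) \<le> G\<^sup>2 * nsq M \<phi>"
proof -
  note [measurable] = g sq_integrable_measurable[OF \<phi>]
  have int: "integrable M (\<lambda>x. G\<^sup>2 * (cmod (\<phi> x))\<^sup>2)"
    using \<phi> by (simp add: sq_integrable_def)
  have le: "(cmod (complex_of_real (g x) * \<phi> x))\<^sup>2 \<le> G\<^sup>2 * (cmod (\<phi> x))\<^sup>2" if "x \<in> space M" for x
    using bd[OF that] by (auto simp: norm_mult power_mult_distrib abs_le_square_iff[symmetric]
        intro!: mult_right_mono)
  have int': "integrable M (\<lambda>x. (cmod (complex_of_real (g x) * \<phi> x))\<^sup>2)"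
    by (rule Bochner_Integration.integrable_bound[OF int]) (use le in auto)
  then show "sq_integrable M (\<lambda>x. complex_of_real (g x) * \<phi> x)"
    by (simp add: sq_integrable_def)
  have "nsq M (\<lambda>x. complex_of_real (g x) * \<phi> x) \<le> (LINT x|M. G\<^sup>2 * (cmod (\<phi> x))\<^sup>2)"
    unfolding nsq_def by (rule integral_mono[OF int' int le])
  then show "nsq M (\<lambda>x. complex_of_real (g x) * \<phi> x) \<le> G\<^sup>2 * nsq M \<phi>"
    by (simp add: nsq_def)
qed

lemma sq_integrable_cmult:
  assumes "sq_integrable M \<phi>"
  shows "sq_integrable M (\<lambda>x. c * \<phi> x)"
  using assms by (auto simp: sq_integrable_def norm_mult power_mult_distrib)

lemma sq_integrable_add:
  assumes \<phi>: "sq_integrable M \<phi>" and \<psi>: "sq_integrable M \<psi>"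
  shows "sq_integrable M (\<lambda>x. \<phi> x + \<psi> x)"
proof -
  note [measurable] = sq_integrable_measurable[OF \<phi>] sq_integrable_measurable[OF \<psi>]
  have "(cmod (a + b))\<^sup>2 \<le> 2 * (cmod a)\<^sup>2 + 2 * (cmod b)\<^sup>2" for a b
  proof -
    have "(cmod (a + b))\<^sup>2 \<le> (cmod a + cmod b)\<^sup>2"
      by (intro power_mono norm_triangle_ineq) auto
    also have "\<dots> \<le> 2 * (cmod a)\<^sup>2 + 2 * (cmod b)\<^sup>2"
      using sum_squares_bound[of "cmod a" "cmod b"] by (simp add: power2_sum)
    finally show ?thesis .
  qed
  moreover have "integrable M (\<lambda>x. 2 * (cmod (\<phi> x))\<^sup>2 + 2 * (cmod (\<psi> x))\<^sup>2)"
    using assms by (auto simp: sq_integrable_def)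
  ultimately have "integrable M (\<lambda>x. (cmod (\<phi> x + \<psi> x))\<^sup>2)"
    by (elim Bochner_Integration.integrable_bound) auto
  then show ?thesis by (simp add: sq_integrable_def)
qed

lemma sq_integrable_diff:
  assumes "sq_integrable M \<phi>" and "sq_integrable M \<psi>"
  shows "sq_integrable M (\<lambda>x. \<phi> x - \<psi> x)"
  using sq_integrable_add[OF assms(1) sq_integrable_cmult[OF assms(2), of "-1"]] by simp

lemma sq_integrable_zero: "sq_integrable M (\<lambda>x. 0)"
  by (simp add: sq_integrable_def)

lemma sq_integrable_sum:
  assumes "\<And>i. i \<in> I \<Longrightarrow> sq_integrable M (\<phi> i)"
  shows "sq_integrable M (\<lambda>x. \<Sum>i\<in>I. c i * \<phi> i x)"
  using assms
  by (induction I rule: infinite_finite_induct)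
    (auto simp: sq_integrable_zero intro!: sq_integrable_add sq_integrable_cmult)

lemma integrable_ip:
  assumes \<phi>: "sq_integrable M \<phi>" and \<psi>: "sq_integrable M \<psi>"
  shows "integrable M (\<lambda>x. cnj (\<phi> x) * \<psi> x)"
proof -
  note [measurable] = sq_integrable_measurable[OF \<phi>] sq_integrable_measurable[OF \<psi>]
  have m: "(\<lambda>x. cnj (\<phi> x)) \<in> borel_measurable M"
    by (rule borel_measurable_continuous_on[OF _ sq_integrable_measurable[OF \<phi>]])
      (intro continuous_intros)
  have "integrable M (\<lambda>x. (cmod (\<phi> x))\<^sup>2 + (cmod (\<psi> x))\<^sup>2)"
    using assms by (auto simp: sq_integrable_def)
  moreover have "cmod (cnj a * b) \<le> (cmod a)\<^sup>2 + (cmod b)\<^sup>2" for a b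
    using sum_squares_bound[of "cmod a" "cmod b"] mult_nonneg_nonneg[of "cmod a" "cmod b"]
    by (simp add: norm_mult del: mult_nonneg_nonneg)
  ultimately show ?thesis
    using m by (elim Bochner_Integration.integrable_bound) auto
qed

lemma ip_diff_right:
  assumes "sq_integrable M \<phi>" "sq_integrable M \<psi>" "sq_integrable M \<theta>"
  shows "ip M \<phi> (\<lambda>x. \<psi> x - \<theta> x) = ip M \<phi> \<psi> - ip M \<phi> \<theta>"
  by (simp add: ip_def right_diff_distrib integrable_ip assms)

lemma ip_sum_right:
  assumes "sq_integrable M \<phi>" "\<And>i. i \<in> I \<Longrightarrow> sq_integrable M (\<psi> i)"
  shows "ip M \<phi> (\<lambda>x. \<Sum>i\<in>I. c i * \<psi> i x) = (\<Sum>i\<in>I. c i * ip M \<phi> (\<psi> i))"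
proof -
  have "ip M \<phi> (\<lambda>x. \<Sum>i\<in>I. c i * \<psi> i x) = (LINT x|M. (\<Sum>i\<in>I. c i * (cnj (\<phi> x) * \<psi> i x)))"
    by (simp add: ip_def sum_distrib_left algebra_simps)
  also have "\<dots> = (\<Sum>i\<in>I. c i * ip M \<phi> (\<psi> i))"
    by (simp add: ip_def integrable_ip assms)
  finally show ?thesis .
qed

text \<open>Multiplication by a real function is symmetric; this makes the compressed matrices
  Hermitian.\<close>

lemma ip_mult_real_right:
  "ip M \<phi> (\<lambda>x. complex_of_real (g x) * \<psi> x) = ip M (\<lambda>x. complex_of_real (g x) * \<phi> x) \<psi>"
  by (simp add: ip_def algebra_simps)

section \<open>Fourier coefficients and Bessel's inequality\<close>

locale orthonormal_seq =
  fixes M :: "'a measure" and \<phi> :: "nat \<Rightarrow> 'a \<Rightarrow> complex"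
  assumes sq [simp]: "sq_integrable M (\<phi> i)"
    and orth: "ip M (\<phi> i) (\<phi> j) = (if i = j then 1 else 0)"
begin

text \<open>Bessel's inequality, the best approximation property and the isometry of coefficient vectors
  are all instances of this identity.\<close>

lemma nsq_diff_sum:
  assumes \<psi>: "sq_integrable M \<psi>"
  shows "nsq M (\<lambda>x. \<psi> x - (\<Sum>i<n. c i * \<phi> i x)) =
    nsq M \<psi> - (\<Sum>i<n. (cmod (ip M (\<phi> i) \<psi>))\<^sup>2) + (\<Sum>i<n. (cmod (ip M (\<phi> i) \<psi> - c i))\<^sup>2)"
proof -
  define a where "a i = ip M (\<phi> i) \<psi>" for i
  define S where "S = (\<lambda>x. \<Sum>i<n. c i * \<phi> i x)"
  have S: "sq_integrable M S" unfolding S_def by (intro sq_integrable_sum) simp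
  note d = sq_integrable_diff[OF \<psi> S]
  have 1: "ip M (\<phi> j) S = c j" if "j < n" for j
    using that by (simp add: S_def ip_sum_right orth if_distrib sum.delta cong: if_cong)
  have 2: "ip M f S = (\<Sum>i<n. c i * cnj (ip M (\<phi> i) f))" if "sq_integrable M f" for f
    by (simp add: S_def ip_sum_right that) (simp add: ip_commute[of M f])
  \<comment> \<open>The square is expanded against \<open>\<psi>\<close> and \<open>S\<close>
    separately; the mixed terms then complete the squares of \<open>a i - c i\<close>.\<close>
  have "complex_of_real (nsq M (\<lambda>x. \<psi> x - S x)) = ip M (\<lambda>x. \<psi> x - S x) \<psi> - ip M (\<lambda>x. \<psi> x - S x) S"
    unfolding ip_self[symmetric] using \<psi> S d by (intro ip_diff_right)
  also have "ip M (\<lambda>x. \<psi> x - S x) \<psi> = cnj (ip M \<psi> \<psi> - ip M \<psi> S)"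
    using \<psi> S by (subst ip_commute) (simp add: ip_diff_right)
  also have "\<dots> = nsq M \<psi> - (\<Sum>i<n. cnj (c i) * a i)"
    by (simp add: ip_self 2 \<psi> a_def)
  also have "ip M (\<lambda>x. \<psi> x - S x) S = (\<Sum>i<n. c i * cnj (a i - c i))"
    unfolding 2[OF d] using \<psi> S by (intro sum.cong) (simp_all add: ip_diff_right 1 a_def)
  also have "nsq M \<psi> - (\<Sum>i<n. cnj (c i) * a i) - (\<Sum>i<n. c i * cnj (a i - c i)) =
      nsq M \<psi> - (\<Sum>i<n. a i * cnj (a i)) + (\<Sum>i<n. (a i - c i) * cnj (a i - c i))"
    by (simp add: algebra_simps sum.distrib sum_subtractf)
  also have "\<dots> = complex_of_real (nsq M \<psi> - (\<Sum>i<n. (cmod (a i))\<^sup>2) + (\<Sum>i<n. (cmod (a i - c i))\<^sup>2))"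
    by (simp add: complex_norm_square[symmetric] del: complex_cnj_diff)
  finally show ?thesis unfolding S_def a_def of_real_eq_iff .
qed

text \<open>Taking the Fourier coefficients as \<open>c\<close> makes the last sum of
  \<open>nsq_diff_sum\<close> vanish.\<close>

lemma bessel:
  assumes "sq_integrable M \<psi>"
  shows "(\<Sum>i<n. (cmod (ip M (\<phi> i) \<psi>))\<^sup>2) \<le> nsq M \<psi>"
  using nsq_diff_sum[OF assms, where n = n and c = "\<lambda>i. ip M (\<phi> i) \<psi>"]
    nsq_nonneg[of M "\<lambda>x. \<psi> x - (\<Sum>i<n. ip M (\<phi> i) \<psi> * \<phi> i x)"] by simp

lemma nsq_sum: "nsq M (\<lambda>x. \<Sum>i<n. c i * \<phi> i x) = (\<Sum>i<n. (cmod (c i))\<^sup>2)"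
proof -
  have "nsq M (\<lambda>x. \<Sum>i<n. c i * \<phi> i x) = nsq M (\<lambda>x. 0 - (\<Sum>i<n. c i * \<phi> i x))"
    by (simp add: nsq_def)
  also have "\<dots> = (\<Sum>i<n. (cmod (c i))\<^sup>2)"
    by (subst nsq_diff_sum) (simp_all add: sq_integrable_zero, simp add: nsq_def ip_def)
  finally show ?thesis .
qed

text \<open>Let \<open>S\<close> have the coefficients \<open>u\<close> of a unit eigenvector. The
  first Fourier coefficients of \<open>g S\<close> are then \<open>e u\<close>, so Bessel's
  inequality bounds the square of \<open>e\<close> by the squared norm of \<open>g S\<close>. This
  keeps the quadrature nodes in the interval from \<open>-G\<close> to \<open>G\<close>.\<close>

lemma compression_eigenvalue_bound:
  assumes g: "g \<in> borel_measurable M" and bd: "\<And>x. x \<in> space M \<Longrightarrow> \<bar>g x\<bar> \<le> G" and G: "0 \<le> G"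
    and u: "(\<Sum>i<n. (cmod (u i))\<^sup>2) = 1"
    and eigen: "\<And>i. i < n \<Longrightarrow>
      (\<Sum>l<n. ip M (\<phi> i) (\<lambda>x. complex_of_real (g x) * \<phi> l x) * u l) = complex_of_real e * u i"
  shows "\<bar>e\<bar> \<le> G"
proof -
  define S where "S = (\<lambda>x. \<Sum>l<n. u l * \<phi> l x)"
  have S: "sq_integrable M S" unfolding S_def by (intro sq_integrable_sum) simp
  note gS = sq_integrable_bounded_mult[OF S g bd]
  have "ip M (\<phi> i) (\<lambda>x. complex_of_real (g x) * S x) = complex_of_real e * u i" if "i < n" for i
  proof -
    have "ip M (\<phi> i) (\<lambda>x. complex_of_real (g x) * S x) =
        ip M (\<phi> i) (\<lambda>x. \<Sum>l<n. u l * (complex_of_real (g x) * \<phi> l x))"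
      unfolding S_def sum_distrib_left by (simp only: mult.left_commute)
    also have "\<dots> = (\<Sum>l<n. u l * ip M (\<phi> i) (\<lambda>x. complex_of_real (g x) * \<phi> l x))"
      using g bd by (intro ip_sum_right sq sq_integrable_bounded_mult(1)) auto
    finally show ?thesis using eigen[OF that] by (simp only: mult.commute)
  qed
  then have "(\<Sum>i<n. (cmod (complex_of_real e * u i))\<^sup>2) \<le> nsq M (\<lambda>x. complex_of_real (g x) * S x)"
    using bessel[OF gS(1), of n] by simp
  moreover have "nsq M S = 1" unfolding S_def nsq_sum by (rule u)
  moreover have "(\<Sum>i<n. (cmod (complex_of_real e * u i))\<^sup>2) = e\<^sup>2"
    by (simp add: norm_mult power_mult_distrib u flip: sum_distrib_left)
  ultimately have "e\<^sup>2 \<le> G\<^sup>2" using gS(2) by simp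
  then show ?thesis using G by (simp flip: abs_le_square_iff)
qed

end

section \<open>Parseval's identity and convergence of truncated powers\<close>

locale orthonormal_basis = orthonormal_seq +
  assumes dense: "\<And>\<psi> \<epsilon>. sq_integrable M \<psi> \<Longrightarrow> \<epsilon> > 0 \<Longrightarrow>
    \<exists>m c. nsq M (\<lambda>x. \<psi> x - (\<Sum>i<m. c i * \<phi> i x)) < \<epsilon>"
begin

text \<open>The defect in Bessel's inequality for \<open>m\<close> terms is at most the squared
  distance to any combination of the first \<open>m\<close> functions, and it does not grow with
  more terms.\<close>

lemma parseval:
  assumes \<psi>: "sq_integrable M \<psi>"
  shows "(\<lambda>n. \<Sum>i<n. (cmod (ip M (\<phi> i) \<psi>))\<^sup>2) \<longlonglongrightarrow> nsq M \<psi>"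
proof (rule LIMSEQ_I)
  fix r :: real assume "0 < r"
  then obtain m c where mc: "nsq M (\<lambda>x. \<psi> x - (\<Sum>i<m. c i * \<phi> i x)) < r"
    using dense[OF \<psi>] by blast
  have "norm ((\<Sum>i<n. (cmod (ip M (\<phi> i) \<psi>))\<^sup>2) - nsq M \<psi>) < r" if "n \<ge> m" for n
  proof -
    have "(\<Sum>i<m. (cmod (ip M (\<phi> i) \<psi>))\<^sup>2) \<le> (\<Sum>i<n. (cmod (ip M (\<phi> i) \<psi>))\<^sup>2)"
      using that by (intro sum_mono2) auto
    moreover have "0 \<le> (\<Sum>i<m. (cmod (ip M (\<phi> i) \<psi> - c i))\<^sup>2)" by (intro sum_nonneg) auto
    ultimately show ?thesis
      using mc bessel[OF \<psi>, of n] unfolding nsq_diff_sum[OF \<psi>] by simp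
  qed
  then show "\<exists>no. \<forall>n\<ge>no. norm ((\<Sum>i<n. (cmod (ip M (\<phi> i) \<psi>))\<^sup>2) - nsq M \<psi>) < r" by blast
qed

text \<open>The vectors \<open>y n k\<close> are the coefficients of \<open>(P\<^sub>n g)\<^sup>k \<phi>\<^sub>0\<close>, where \<open>P\<^sub>n\<close> is the
  projection onto the span of \<open>\<phi>\<^sub>0, \<dots>, \<phi>\<^sub>n\<close>.\<close>

lemma truncated_powers_converge:
  fixes g :: "'a \<Rightarrow> real" and y :: "nat \<Rightarrow> nat \<Rightarrow> nat \<Rightarrow> complex"
  assumes g: "g \<in> borel_measurable M" and bd: "\<And>x. x \<in> space M \<Longrightarrow> \<bar>g x\<bar> \<le> G"
    and y0: "\<And>n i. i \<le> n \<Longrightarrow> y n 0 i = (if i = 0 then 1 else 0)"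
    and ySuc: "\<And>n k i. i \<le> n \<Longrightarrow> y n (Suc k) i =
      (\<Sum>l<Suc n. ip M (\<phi> i) (\<lambda>x. complex_of_real (g x) * \<phi> l x) * y n k l)"
  shows "(\<lambda>n. y n k 0) \<longlonglongrightarrow> ip M (\<phi> 0) (\<lambda>x. complex_of_real (g x ^ k) * \<phi> 0 x)"
proof -
  define V where "V n k = (\<lambda>x. \<Sum>i<Suc n. y n k i * \<phi> i x)" for n k
  define p where "p k = (\<lambda>x. complex_of_real (g x ^ k) * \<phi> 0 x)" for k
  have V: "sq_integrable M (V n k)" for n k
    unfolding V_def by (intro sq_integrable_sum) simp
  have p_Suc: "p (Suc k) = (\<lambda>x. complex_of_real (g x) * p k x)" for k
    by (simp add: p_def mult.assoc)
  have p: "sq_integrable M (p k)" for k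
  proof (induction k)
    case 0
    then show ?case by (simp add: p_def)
  next
    case (Suc k)
    then show ?case unfolding p_Suc by (rule sq_integrable_bounded_mult[OF _ g bd])
  qed
  have y_ip: "y n (Suc k) i = ip M (\<phi> i) (\<lambda>x. complex_of_real (g x) * V n k x)" if "i \<le> n" for n k i
  proof -
    have "ip M (\<phi> i) (\<lambda>x. complex_of_real (g x) * V n k x) =
        ip M (\<phi> i) (\<lambda>x. \<Sum>l<Suc n. y n k l * (complex_of_real (g x) * \<phi> l x))"
      unfolding V_def sum_distrib_left by (simp only: mult.left_commute)
    also have "\<dots> = (\<Sum>l<Suc n. y n k l * ip M (\<phi> i) (\<lambda>x. complex_of_real (g x) * \<phi> l x))"
      using g bd by (intro ip_sum_right sq sq_integrable_bounded_mult(1)) auto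
    finally show ?thesis unfolding ySuc[OF that] by (simp only: mult.commute)
  qed
  \<comment> \<open>The new error consists of the distance from \<open>p (Suc k)\<close> to the
    span, which vanishes by Parseval, and the projection of \<open>g\<close> times the previous
    error, whose squared norm grows by at most the factor \<open>G\<^sup>2\<close>.\<close>
  have lim: "(\<lambda>n. nsq M (\<lambda>x. p k x - V n k x)) \<longlonglongrightarrow> 0" for k
  proof (induction k)
    case 0
    have "nsq M (\<lambda>x. p 0 x - V n 0 x) = 0" for n
    proof -
      have "V n 0 = p 0"
        by (auto simp: V_def p_def y0 if_distrib[of "\<lambda>c. c * _"] cong: if_cong)
      then show ?thesis by (simp add: nsq_def)
    qed
    then show ?case by simp
  next
    case (Suc k)
    define r where "r n = nsq M (p (Suc k)) - (\<Sum>i<Suc n. (cmod (ip M (\<phi> i) (p (Suc k))))\<^sup>2)" for n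
    have "r \<longlonglongrightarrow> nsq M (p (Suc k)) - nsq M (p (Suc k))"
      unfolding r_def using parseval[OF p[of "Suc k"]] by (intro tendsto_intros LIMSEQ_Suc)
    moreover have "(\<lambda>n. G\<^sup>2 * nsq M (\<lambda>x. p k x - V n k x)) \<longlonglongrightarrow> G\<^sup>2 * 0"
      by (intro tendsto_intros Suc)
    ultimately have lim0: "(\<lambda>n. r n + G\<^sup>2 * nsq M (\<lambda>x. p k x - V n k x)) \<longlonglongrightarrow> 0"
      using tendsto_add[of r 0] by simp
    have bound: "nsq M (\<lambda>x. p (Suc k) x - V n (Suc k) x) \<le> r n + G\<^sup>2 * nsq M (\<lambda>x. p k x - V n k x)" for n
    proof -
      let ?d = "\<lambda>x. complex_of_real (g x) * (p k x - V n k x)"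
      have d: "sq_integrable M ?d" "nsq M ?d \<le> G\<^sup>2 * nsq M (\<lambda>x. p k x - V n k x)"
        using sq_integrable_bounded_mult[OF sq_integrable_diff[OF p V] g bd] by blast+
      have "ip M (\<phi> i) (p (Suc k)) - y n (Suc k) i = ip M (\<phi> i) ?d" if "i < Suc n" for i
      proof -
        have "ip M (\<phi> i) ?d =
            ip M (\<phi> i) (\<lambda>x. complex_of_real (g x) * p k x - complex_of_real (g x) * V n k x)"
          by (simp only: right_diff_distrib)
        also have "\<dots> = ip M (\<phi> i) (p (Suc k)) - y n (Suc k) i"
          unfolding p_Suc using that g bd
          by (subst ip_diff_right) (auto simp: y_ip intro!: sq_integrable_bounded_mult(1) p V)
        finally show ?thesis ..
      qed
      then have "(\<Sum>i<Suc n. (cmod (ip M (\<phi> i) (p (Suc k)) - y n (Suc k) i))\<^sup>2) \<le> nsq M ?d"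
        using bessel[OF d(1), of "Suc n"] by simp
      then show ?thesis
        using d(2) unfolding V_def[of n "Suc k"] nsq_diff_sum[OF p] r_def by linarith
    qed
    show ?case
      by (rule tendsto_sandwich[OF _ _ tendsto_const lim0]) (simp_all add: nsq_nonneg bound)
  qed
  \<comment> \<open>A single coefficient of the error is dominated by its norm.\<close>
  have "(\<lambda>n. (cmod (ip M (\<phi> 0) (p k) - y n k 0))\<^sup>2) \<longlonglongrightarrow> 0"
  proof (rule tendsto_sandwich[OF _ _ tendsto_const lim[of k]])
    have "(cmod (ip M (\<phi> 0) (p k) - y n k 0))\<^sup>2 \<le> nsq M (\<lambda>x. p k x - V n k x)" for n
    proof -
      have "(\<Sum>i<Suc n. (cmod (ip M (\<phi> i) (p k) - y n k i))\<^sup>2) \<ge> (cmod (ip M (\<phi> 0) (p k) - y n k 0))\<^sup>2"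
        by (rule member_le_sum[of 0]) auto
      then show ?thesis
        using bessel[OF p[of k], where n = "Suc n"] unfolding V_def nsq_diff_sum[OF p] by linarith
    qed
    then show "\<forall>\<^sub>F n in sequentially. (cmod (ip M (\<phi> 0) (p k) - y n k 0))\<^sup>2 \<le> nsq M (\<lambda>x. p k x - V n k x)"
      by simp
  qed auto
  then have "(\<lambda>n. sqrt ((cmod (ip M (\<phi> 0) (p k) - y n k 0))\<^sup>2)) \<longlonglongrightarrow> sqrt 0"
    by (rule tendsto_real_sqrt)
  then have "(\<lambda>n. y n k 0) \<longlonglongrightarrow> ip M (\<phi> 0) (p k)"
    by (simp add: Lim_null[of "\<lambda>n. y n k 0"] tendsto_norm_zero_iff norm_minus_commute)
  then show ?thesis by (simp add: p_def)
qed

end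

section \<open>Convergence of quadrature rules from convergence of moments\<close>

text \<open>Separates the measure-theoretic limit from the matrices: rule \<open>n\<close> has
  \<open>Suc n\<close> nodes \<open>ev n j\<close> with weights \<open>p n j\<close>.\<close>

locale moment_quadrature = prob_space M for M :: "'a measure" +
  fixes g :: "'a \<Rightarrow> real" and G :: real and p ev :: "nat \<Rightarrow> nat \<Rightarrow> real"
  assumes g [measurable]: "g \<in> borel_measurable M"
    and g_bound: "\<And>x. x \<in> space M \<Longrightarrow> \<bar>g x\<bar> \<le> G"
    and p_nonneg: "\<And>n j. 0 \<le> p n j"
    and p_sum: "\<And>n. (\<Sum>j<Suc n. p n j) = 1"
    and ev_bound: "\<And>n j. j < Suc n \<Longrightarrow> \<bar>ev n j\<bar> \<le> G"
    and moments: "\<And>k. (\<lambda>n. \<Sum>j<Suc n. p n j * ev n j ^ k) \<longlonglongrightarrow> (LINT x|M. g x ^ k)"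
begin

lemma weighted_sum_le:
  assumes "\<And>j. j < Suc n \<Longrightarrow> \<bar>a j\<bar> \<le> b j"
  shows "\<bar>\<Sum>j<Suc n. p n j * a j\<bar> \<le> (\<Sum>j<Suc n. p n j * b j)"
proof -
  have "\<bar>\<Sum>j<Suc n. p n j * a j\<bar> \<le> (\<Sum>j<Suc n. \<bar>p n j * a j\<bar>)" by (rule sum_abs)
  also have "\<dots> \<le> (\<Sum>j<Suc n. p n j * b j)"
    using assms p_nonneg by (intro sum_mono) (auto simp: abs_mult intro!: mult_left_mono)
  finally show ?thesis .
qed

lemma integrable_comp_bounded:
  fixes h :: "real \<Rightarrow> real"
  assumes "h \<in> borel_measurable borel" "\<And>t. \<bar>t\<bar> \<le> G \<Longrightarrow> \<bar>h t\<bar> \<le> B"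
  shows "integrable M (\<lambda>x. h (g x))"
  by (rule integrable_const_bound[where B = B]) (use assms g g_bound in auto)

text \<open>Approximate \<open>h\<close> uniformly on the interval from \<open>-G\<close> to
  \<open>G\<close> by a polynomial. The moments settle the polynomial, and since nodes and values of
  \<open>g\<close> lie in the interval and all total masses are 1, the replacement costs at most
  \<open>r / 3\<close> on either side.\<close>

lemma continuous_converge:
  assumes h: "continuous_on UNIV h"
  shows "(\<lambda>n. \<Sum>j<Suc n. p n j * h (ev n j)) \<longlonglongrightarrow> (LINT x|M. h (g x))"
proof (rule LIMSEQ_I)
  fix r :: real assume r: "0 < r"
  have hG: "continuous_on {-G..G} h" using h continuous_on_subset by blast
  obtain q where q: "real_polynomial_function q" "\<And>t. t \<in> {-G..G} \<Longrightarrow> \<bar>h t - q t\<bar> < r / 3"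
    using Stone_Weierstrass_real_polynomial_function[OF _ hG, of "r / 3"] r by auto
  obtain a d where qd: "q = (\<lambda>t. \<Sum>i\<le>d. a i * t ^ i)"
    using q(1) real_polynomial_function_iff_sum by auto
  have bdd: "\<exists>B. \<forall>t. \<bar>t\<bar> \<le> G \<longrightarrow> \<bar>k t\<bar> \<le> B" if "continuous_on UNIV k" for k :: "real \<Rightarrow> real"
  proof -
    have "bounded (k ` {-G..G})"
      using that by (intro compact_imp_bounded compact_continuous_image)
        (auto intro: continuous_on_subset)
    then obtain b where "\<forall>t\<in>{-G..G}. \<bar>k t\<bar> \<le> b" by (auto simp: bounded_iff)
    then show ?thesis by (intro exI[of _ b]) (simp add: abs_le_iff)
  qed
  have int: "integrable M (\<lambda>x. k (g x))" if "continuous_on UNIV k" for k :: "real \<Rightarrow> real"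
    using bdd[OF that] integrable_comp_bounded borel_measurable_continuous_onI[OF that] by blast
  have int_pow: "integrable M (\<lambda>x. g x ^ i)" for i
    using int[of "\<lambda>t. t ^ i"] by (simp add: continuous_intros)
  have int_q: "integrable M (\<lambda>x. q (g x))"
    unfolding qd using int_pow by simp
  have "(\<lambda>n. \<Sum>i\<le>d. a i * (\<Sum>j<Suc n. p n j * ev n j ^ i)) \<longlonglongrightarrow> (\<Sum>i\<le>d. a i * (LINT x|M. g x ^ i))"
    by (intro tendsto_intros moments)
  moreover have "(\<Sum>i\<le>d. a i * (LINT x|M. g x ^ i)) = (LINT x|M. q (g x))"
    unfolding qd using int_pow by simp
  moreover have "(\<Sum>i\<le>d. a i * (\<Sum>j<Suc n. p n j * ev n j ^ i)) = (\<Sum>j<Suc n. p n j * q (ev n j))" for n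
    unfolding qd sum_distrib_left by (subst sum.swap) (simp only: mult.left_commute)
  ultimately have lim_q: "(\<lambda>n. \<Sum>j<Suc n. p n j * q (ev n j)) \<longlonglongrightarrow> (LINT x|M. q (g x))" by simp
  obtain N where N: "\<And>n. n \<ge> N \<Longrightarrow> \<bar>(\<Sum>j<Suc n. p n j * q (ev n j)) - (LINT x|M. q (g x))\<bar> < r / 3"
    using LIMSEQ_D[OF lim_q, of "r / 3"] r by auto
  have hq: "\<bar>h t - q t\<bar> \<le> r / 3" if "\<bar>t\<bar> \<le> G" for t
    using q(2)[of t] that by (simp add: abs_le_iff)
  have e1: "\<bar>(\<Sum>j<Suc n. p n j * h (ev n j)) - (\<Sum>j<Suc n. p n j * q (ev n j))\<bar> \<le> r / 3" for n
  proof -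
    have "\<bar>\<Sum>j<Suc n. p n j * (h (ev n j) - q (ev n j))\<bar> \<le> (\<Sum>j<Suc n. p n j * (r / 3))"
      by (intro weighted_sum_le hq ev_bound)
    also have "\<dots> = r / 3" by (simp only: p_sum mult_1_left flip: sum_distrib_right)
    finally show ?thesis by (simp only: right_diff_distrib sum_subtractf)
  qed
  have e2: "\<bar>(LINT x|M. h (g x)) - (LINT x|M. q (g x))\<bar> \<le> r / 3"
  proof -
    have "\<bar>LINT x|M. h (g x) - q (g x)\<bar> \<le> (LINT x|M. \<bar>h (g x) - q (g x)\<bar>)"
      by (rule integral_abs_bound)
    also have "\<dots> \<le> (LINT x|M. r / 3)"
      using int[OF h] int_q by (intro integral_mono hq g_bound) auto
    also have "\<dots> = r / 3" by (simp add: prob_space)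
    finally show ?thesis using int[OF h] int_q by simp
  qed
  have "norm ((\<Sum>j<Suc n. p n j * h (ev n j)) - (LINT x|M. h (g x))) < r" if "n \<ge> N" for n
    using e1[of n] e2 N[OF that] unfolding real_norm_def by linarith
  then show "\<exists>no. \<forall>n\<ge>no. norm ((\<Sum>j<Suc n. p n j * h (ev n j)) - (LINT x|M. h (g x))) < r" by blast
qed

text \<open>The function \<open>f\<close> need not be Borel measurable on \<open>C\<close>, so the limit is stated for its
  modification that vanishes there. Multiplying \<open>f\<close> by the cutoff \<open>min 1 (m * infdist t C)\<close> makes it
  continuous, and the same cutoff shows that the quadrature rules do not charge \<open>C\<close> in the limit.\<close>

lemma almost_continuous_converge:
  assumes C: "closed C" "C \<noteq> {}" and f: "\<And>t. t \<notin> C \<Longrightarrow> isCont f t" and B: "\<And>t. \<bar>f t\<bar> \<le> B"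
    and null: "AE x in M. g x \<notin> C"
  shows "(\<lambda>t. if t \<in> C then 0 else f t) \<in> borel_measurable borel"
    and "(\<lambda>n. \<Sum>j<Suc n. p n j * f (ev n j)) \<longlonglongrightarrow> (LINT x|M. (if g x \<in> C then 0 else f (g x)))"
proof -
  define F where "F t = (if t \<in> C then 0 else f t)" for t
  define h where "h m t = min 1 (real m * infdist t C)" for m t
  have h01: "0 \<le> h m t" "h m t \<le> 1" for m t by (auto simp: h_def infdist_nonneg)
  have B0: "0 \<le> B" using B[of 0] by linarith
  have conth: "continuous_on UNIV (h m)" for m
    unfolding h_def by (intro continuous_intros)
  have contf: "continuous_on UNIV (\<lambda>t. f t * h m t)" for m
  proof (rule continuous_at_imp_continuous_on, rule ballI)
    fix t
    show "isCont (\<lambda>t. f t * h m t) t"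
    proof (cases "t \<in> C")
      case False
      then show ?thesis
        using f conth[of m] by (auto intro!: continuous_intros simp: continuous_on_eq_continuous_at)
    next
      case True
      have "((\<lambda>s. B * h m s) \<longlongrightarrow> B * h m t) (at t)"
        using conth[of m] by (intro tendsto_intros) (auto simp: continuous_on_eq_continuous_at isCont_def)
      moreover have ht: "h m t = 0" using True by (simp add: h_def)
      ultimately have "((\<lambda>s. f s * h m s) \<longlongrightarrow> 0) (at t)"
        by (intro Lim_null_comparison[of "\<lambda>s. f s * h m s" "\<lambda>s. B * h m s"])
          (auto simp: abs_mult B h01 intro!: always_eventually mult_right_mono)
      then show ?thesis by (simp add: isCont_def ht)
    qed
  qed
  have h_lim: "(\<lambda>m. h m t) \<longlonglongrightarrow> (if t \<in> C then 0 else 1)" for t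
  proof (cases "t \<in> C")
    case True
    then show ?thesis by (simp add: h_def)
  next
    case False
    \<comment> \<open>Off a closed nonempty set the distance is positive, so the cutoff equals 1 for
      all large \<open>m\<close>.\<close>
    then have pos: "infdist t C > 0" using C in_closed_iff_infdist_zero infdist_nonneg
      by (metis less_eq_real_def)
    obtain m0 where "1 < real m0 * infdist t C" using reals_Archimedean3[OF pos] by auto
    then have "h m t = 1" if "m \<ge> m0" for m
      using that pos mult_right_mono[of "real m0" "real m" "infdist t C"]
      unfolding h_def by (intro min_absorb1) linarith
    then show ?thesis
      using False by (intro tendsto_eventually) (auto simp: eventually_sequentially)
  qed
  have F_lim: "(\<lambda>m. f t * h m t) \<longlonglongrightarrow> F t" for t
    using tendsto_mult[OF tendsto_const h_lim[of t], of "f t"] by (simp add: F_def split: if_splits)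
  \<comment> \<open>\<open>F\<close> is a pointwise limit of continuous functions.\<close>
  have F_meas [measurable]: "F \<in> borel_measurable borel"
    by (rule borel_measurable_LIMSEQ_real[OF F_lim]) (intro borel_measurable_continuous_onI contf)
  then show "(\<lambda>t. if t \<in> C then 0 else f t) \<in> borel_measurable borel"
    by (simp add: F_def[abs_def])
  have hm [measurable]: "h m \<in> borel_measurable borel" "(\<lambda>t. f t * h m t) \<in> borel_measurable borel" for m
    using conth contf by (auto intro: borel_measurable_continuous_onI)
  have lim1: "(\<lambda>m. LINT x|M. f (g x) * h m (g x)) \<longlonglongrightarrow> (LINT x|M. F (g x))"
  proof (rule integral_dominated_convergence[where w = "\<lambda>_. B"])
    show "(\<lambda>x. f (g x) * h m (g x)) \<in> borel_measurable M" for m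
      using measurable_compose[OF g hm(2)] .
    have "\<bar>f t * h m t\<bar> \<le> B" for t m
      using mult_mono[OF B h01(2) _ h01(1), of t m t] B0 h01[of m t] by (simp add: abs_mult)
    then show "AE x in M. norm (f (g x) * h m (g x)) \<le> B" for m by simp
  qed (use F_lim in auto)
  \<comment> \<open>As \<open>g\<close> avoids \<open>C\<close> almost everywhere, the cutoff
    removes no mass in the limit.\<close>
  have "(\<lambda>m. LINT x|M. h m (g x)) \<longlonglongrightarrow> (LINT x|M. 1)"
  proof (rule integral_dominated_convergence[where w = "\<lambda>_. 1"])
    show "AE x in M. (\<lambda>m. h m (g x)) \<longlonglongrightarrow> 1"
      using null by eventually_elim (use h_lim in \<open>metis\<close>)
  qed (use h01 in auto)
  then have lim2: "(\<lambda>m. LINT x|M. h m (g x)) \<longlonglongrightarrow> 1" by (simp add: prob_space)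
  have "(\<lambda>n. \<Sum>j<Suc n. p n j * f (ev n j)) \<longlonglongrightarrow> (LINT x|M. F (g x))"
  proof (rule LIMSEQ_I)
    fix r :: real assume r: "0 < r"
    \<comment> \<open>The summand 1 in the denominator covers \<open>B = 0\<close> and makes
      \<open>B * \<delta>\<close> strictly less than \<open>r / 2\<close>.\<close>
    define \<delta> where "\<delta> = r / (2 * (B + 1))"
    have \<delta>: "0 < \<delta>" "B * \<delta> < r / 2"
      using r B0 by (auto simp: \<delta>_def field_simps)
    have "\<forall>\<^sub>F m in sequentially. \<bar>(LINT x|M. f (g x) * h m (g x)) - (LINT x|M. F (g x))\<bar> < r / 4"
      using tendstoD[OF lim1, of "r / 4"] r by (simp add: dist_real_def)
    moreover have "\<forall>\<^sub>F m in sequentially. \<bar>(LINT x|M. h m (g x)) - 1\<bar> < \<delta> / 2"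
      using tendstoD[OF lim2, of "\<delta> / 2"] \<delta> by (simp add: dist_real_def)
    \<comment> \<open>The cutoff is fixed first, using only the distribution of \<open>g\<close>;
      \<open>n\<close> is then taken large for this \<open>m\<close>.\<close>
    ultimately obtain m where m: "\<bar>(LINT x|M. f (g x) * h m (g x)) - (LINT x|M. F (g x))\<bar> < r / 4"
      "\<bar>(LINT x|M. h m (g x)) - 1\<bar> < \<delta> / 2"
      using eventually_happens'[OF sequentially_bot eventually_conj] by blast
    have "\<forall>\<^sub>F n in sequentially.
        \<bar>(\<Sum>j<Suc n. p n j * (f (ev n j) * h m (ev n j))) - (LINT x|M. f (g x) * h m (g x))\<bar> < r / 4"
      using tendstoD[OF continuous_converge[OF contf[of m]], of "r / 4"] r by (simp add: dist_real_def)
    moreover have "\<forall>\<^sub>F n in sequentially.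
        \<bar>(\<Sum>j<Suc n. p n j * h m (ev n j)) - (LINT x|M. h m (g x))\<bar> < \<delta> / 2"
      using tendstoD[OF continuous_converge[OF conth[of m]], of "\<delta> / 2"] \<delta> by (simp add: dist_real_def)
    ultimately have "\<forall>\<^sub>F n in sequentially.
        norm ((\<Sum>j<Suc n. p n j * f (ev n j)) - (LINT x|M. F (g x))) < r"
    proof eventually_elim
      case (elim n)
      \<comment> \<open>Cutting off \<open>f\<close> costs at most \<open>B\<close> times the mass
        that the rule gives to \<open>1 - h m\<close>. This mass is below \<open>\<delta>\<close>
        because the rule converges for the continuous function \<open>h m\<close>.\<close>
      have "\<bar>\<Sum>j<Suc n. p n j * (f (ev n j) - f (ev n j) * h m (ev n j))\<bar> \<le>
          (\<Sum>j<Suc n. p n j * (B * (1 - h m (ev n j))))"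
      proof (rule weighted_sum_le)
        fix j
        have "\<bar>f (ev n j) - f (ev n j) * h m (ev n j)\<bar> = \<bar>f (ev n j)\<bar> * \<bar>1 - h m (ev n j)\<bar>"
          by (simp add: right_diff_distrib flip: abs_mult)
        also have "\<dots> \<le> B * (1 - h m (ev n j))"
          using B h01 by (auto intro: mult_right_mono)
        finally show "\<bar>f (ev n j) - f (ev n j) * h m (ev n j)\<bar> \<le> B * (1 - h m (ev n j))" .
      qed
      also have "\<dots> = B * ((\<Sum>j<Suc n. p n j) - (\<Sum>j<Suc n. p n j * h m (ev n j)))"
        by (simp only: sum_distrib_left right_diff_distrib sum_subtractf mult.left_commute[of B] mult.commute[of B]
            mult.assoc mult_1_right mult_1_left)
      also have "\<dots> \<le> B * \<delta>"
      proof (rule mult_left_mono[OF _ B0])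
        show "(\<Sum>j<Suc n. p n j) - (\<Sum>j<Suc n. p n j * h m (ev n j)) \<le> \<delta>"
          using elim(2) m(2) unfolding p_sum by linarith
      qed
      finally have "\<bar>(\<Sum>j<Suc n. p n j * f (ev n j)) - (\<Sum>j<Suc n. p n j * (f (ev n j) * h m (ev n j)))\<bar> < r / 2"
        using \<delta>(2) by (simp only: right_diff_distrib sum_subtractf)
      then show ?case using elim(1) m(1) unfolding real_norm_def by linarith
    qed
    then show "\<exists>no. \<forall>n\<ge>no. norm ((\<Sum>j<Suc n. p n j * f (ev n j)) - (LINT x|M. F (g x))) < r"
      by (simp only: eventually_sequentially)
  qed
  then show "(\<lambda>n. \<Sum>j<Suc n. p n j * f (ev n j)) \<longlonglongrightarrow> (LINT x|M. (if g x \<in> C then 0 else f (g x)))"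
    by (simp only: F_def)
qed

end

section \<open>Compressions of multiplication operators\<close>

text \<open>Counterpart of \<open>mult_matrix\<close> for a general measure;
  \<open>mult_matrix_eq_compression\<close> identifies the two.\<close>

definition compression :: "'a measure \<Rightarrow> (nat \<Rightarrow> 'a \<Rightarrow> complex) \<Rightarrow> ('a \<Rightarrow> real) \<Rightarrow> nat \<Rightarrow> complex mat" where
  "compression M \<phi> g n =
     mat (Suc n) (Suc n) (\<lambda>(i, j). ip M (\<phi> i) (\<lambda>x. complex_of_real (g x) * \<phi> j x))"

lemma compression_hermitian: "mat_adjoint (compression M \<phi> g n) = compression M \<phi> g n"
proof (rule eq_matI)
  fix i j assume ij: "i < dim_row (compression M \<phi> g n)" "j < dim_col (compression M \<phi> g n)"
  have "cnj (ip M (\<phi> j) (\<lambda>x. complex_of_real (g x) * \<phi> i x)) =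
      ip M (\<phi> i) (\<lambda>x. complex_of_real (g x) * \<phi> j x)"
    by (simp only: ip_mult_real_right[of M "\<phi> i"] ip_commute[of M "\<lambda>x. complex_of_real (g x) * \<phi> i x"])
  then show "mat_adjoint (compression M \<phi> g n) $$ (i, j) = compression M \<phi> g n $$ (i, j)"
    using ij by (simp add: compression_def)
qed (simp_all add: compression_def)

text \<open>The nodes are the eigenvalues and the weights come from the first row of the
  diagonalizing matrix. Neither depends on \<open>f\<close>, so one family of rules serves every
  function.\<close>

lemma (in orthonormal_basis) compression_quadrature:
  assumes M: "prob_space M" and g: "g \<in> borel_measurable M"
    and bd: "\<And>x. x \<in> space M \<Longrightarrow> \<bar>g x\<bar> \<le> G" and one: "AE x in M. \<phi> 0 x = 1"
  obtains p ev where "moment_quadrature M g G p ev"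
    "\<And>n f. hermitian_fun f (compression M \<phi> g n) \<in> carrier_mat (Suc n) (Suc n)"
    "\<And>n f. hermitian_fun f (compression M \<phi> g n) $$ (0, 0) =
       complex_of_real (\<Sum>j<Suc n. p n j * f (ev n j))"
proof -
  interpret prob_space M by (rule M)
  let ?A = "compression M \<phi> g"
  have A: "?A n \<in> carrier_mat (Suc n) (Suc n)" for n by (simp add: compression_def)
  have "\<exists>U ev. unitary_mat (Suc n) U \<and>
      ?A n = U * mat_diag (Suc n) (\<lambda>i. complex_of_real (ev i)) * mat_adjoint U" for n
    using hermitian_diagonalization[OF A compression_hermitian] by blast
  then obtain U ev where U: "\<And>n. unitary_mat (Suc n) (U n)"
    and AU: "\<And>n. ?A n = U n * mat_diag (Suc n) (\<lambda>i. complex_of_real (ev n i)) * mat_adjoint (U n)"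
    by metis
  note Uc = unitary_matD[OF U]
  define D where "D n h = mat_diag (Suc n) (\<lambda>i. complex_of_real (h (ev n i)))" for n and h :: "real \<Rightarrow> real"
  have D: "D n h \<in> carrier_mat (Suc n) (Suc n)" for n h by (simp add: D_def)
  \<comment> \<open>\<open>H n h\<close> is the function \<open>h\<close> of the \<open>n\<close>-th
    compression. It is multiplicative in \<open>h\<close>, so the monomials yield the matrix
    powers.\<close>
  define H where "H n h = U n * D n h * mat_adjoint (U n)" for n h
  have H: "H n h \<in> carrier_mat (Suc n) (Suc n)" for n h
    using Uc(1)[of n] D[of n h] by (simp add: H_def mult_carrier_mat[where n = "Suc n"])
  have AH: "?A n = H n (\<lambda>t. t)" for n by (simp add: AU H_def D_def)
  have fH: "hermitian_fun f (?A n) = H n f" for n f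
    using hermitian_fun_diagonalized[OF U AU] by (simp add: H_def D_def)
  have H_mult: "H n h * H n k = H n (\<lambda>t. h t * k t)" for n h k
  proof -
    note assoc = assoc_mult_mat[where ?n\<^sub>1 = "Suc n" and ?n\<^sub>2 = "Suc n" and ?n\<^sub>3 = "Suc n" and ?n\<^sub>4 = "Suc n"]
      mult_carrier_mat[where n = "Suc n"]
    have "H n h * H n k = U n * D n h * (mat_adjoint (U n) * U n) * (D n k * mat_adjoint (U n))"
      unfolding H_def using Uc(1)[of n] D by (simp add: assoc)
    also have "\<dots> = U n * (D n h * D n k) * mat_adjoint (U n)"
      using Uc(1)[of n] D by (simp add: Uc assoc right_mult_one_mat[where nr = "Suc n"])
    also have "D n h * D n k = D n (\<lambda>t. h t * k t)" by (simp add: D_def)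
    finally show ?thesis by (simp add: H_def)
  qed
  define p where "p n j = (cmod (U n $$ (0, j)))\<^sup>2" for n j
  have H00: "H n h $$ (0, 0) = complex_of_real (\<Sum>j<Suc n. p n j * h (ev n j))" for n h
  proof -
    have "H n h $$ (0, 0) =
        (\<Sum>j<Suc n. U n $$ (0, j) * complex_of_real (h (ev n j)) * cnj (U n $$ (0, j)))"
      unfolding H_def D_def by (rule index_diagonalized[OF Uc(1)]) auto
    also have "\<dots> = complex_of_real (\<Sum>j<Suc n. p n j * h (ev n j))"
      unfolding of_real_sum p_def of_real_mult complex_norm_square by (simp only: mult_ac)
    finally show ?thesis .
  qed
  have H_one: "H n (\<lambda>t. 1) = 1\<^sub>m (Suc n)" for n
    using Uc(1)[of n] by (simp add: H_def D_def Uc right_mult_one_mat[where nr = "Suc n"])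
  have "moment_quadrature M g G p ev"
  proof unfold_locales
    show "(\<Sum>j<Suc n. p n j) = 1" for n
      using H00[of n "\<lambda>_. 1"] unfolding H_one
      by (simp del: sum.lessThan_Suc of_real_sum)
    show "\<bar>ev n j\<bar> \<le> G" if j: "j < Suc n" for n j
    \<comment> \<open>The columns of \<open>U n\<close> are unit eigenvectors.\<close>
    proof (rule compression_eigenvalue_bound[OF g bd, where u = "\<lambda>i. U n $$ (i, j)" and n = "Suc n"])
      obtain x where "x \<in> space M" using not_empty by blast
      then show "0 \<le> G" using bd[of x] by linarith
      have "(mat_adjoint (U n) * U n) $$ (j, j) = (\<Sum>i<Suc n. mat_adjoint (U n) $$ (j, i) * U n $$ (i, j))"
        by (rule index_mult_mat_sum) (use Uc(1)[of n] j in auto)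
      also have "\<dots> = (\<Sum>i<Suc n. complex_of_real ((cmod (U n $$ (i, j)))\<^sup>2))"
        using Uc(1)[of n] j by (intro sum.cong) (auto simp: complex_norm_square mult.commute simp del: of_real_power)
      finally show "(\<Sum>i<Suc n. (cmod (U n $$ (i, j)))\<^sup>2) = 1"
        using j by (simp add: Uc del: sum.lessThan_Suc of_real_sum of_real_power flip: of_real_sum)
      fix i assume i: "i < Suc n"
      have "?A n * U n = U n * D n (\<lambda>t. t) * (mat_adjoint (U n) * U n)"
        unfolding AH H_def
        using Uc(1)[of n] D by (intro assoc_mult_mat[where ?n\<^sub>1 = "Suc n" and ?n\<^sub>2 = "Suc n" and ?n\<^sub>3 = "Suc n"])
          (auto intro: mult_carrier_mat[where n = "Suc n"])
      also have "\<dots> = U n * D n (\<lambda>t. t)"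
        using Uc(1)[of n] D by (simp add: Uc right_mult_one_mat[where nr = "Suc n"]
            mult_carrier_mat[where n = "Suc n"])
      finally have AUD: "?A n * U n = U n * D n (\<lambda>t. t)" .
      have "(\<Sum>l<Suc n. ?A n $$ (i, l) * U n $$ (l, j)) = (U n * D n (\<lambda>t. t)) $$ (i, j)"
        unfolding AUD[symmetric] by (rule index_mult_mat_sum[symmetric, OF A Uc(1) i j])
      also have "\<dots> = complex_of_real (ev n j) * U n $$ (i, j)"
        using i j by (simp add: D_def mat_diag_mult_right[OF Uc(1)])
      finally show "(\<Sum>l<Suc n. ip M (\<phi> i) (\<lambda>x. complex_of_real (g x) * \<phi> l x) * U n $$ (l, j)) =
          complex_of_real (ev n j) * U n $$ (i, j)"
        using i by (simp add: compression_def)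
    qed
    show "(\<lambda>n. \<Sum>j<Suc n. p n j * ev n j ^ k) \<longlonglongrightarrow> expectation (\<lambda>x. g x ^ k)" for k
    proof -
      \<comment> \<open>The first columns of the matrix powers satisfy the recursion for the
        coefficients of the truncated powers.\<close>
      have "(\<lambda>n. H n (\<lambda>t. t ^ k) $$ (0, 0)) \<longlonglongrightarrow>
          ip M (\<phi> 0) (\<lambda>x. complex_of_real (g x ^ k) * \<phi> 0 x)"
      proof (rule truncated_powers_converge[OF g bd, where y = "\<lambda>n k i. H n (\<lambda>t. t ^ k) $$ (i, 0)"])
        fix n i k :: nat assume i: "i \<le> n"
        show "H n (\<lambda>t. t ^ 0) $$ (i, 0) = (if i = 0 then 1 else 0)"
          using i by (simp add: H_one)
        have "H n (\<lambda>t. t ^ Suc k) = ?A n * H n (\<lambda>t. t ^ k)"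
          by (simp add: AH H_mult)
        then have "H n (\<lambda>t. t ^ Suc k) $$ (i, 0) = (\<Sum>l<Suc n. ?A n $$ (i, l) * H n (\<lambda>t. t ^ k) $$ (l, 0))"
          using index_mult_mat_sum[OF A H, of i n 0] i by simp
        then show "H n (\<lambda>t. t ^ Suc k) $$ (i, 0) = (\<Sum>l<Suc n.
            ip M (\<phi> i) (\<lambda>x. complex_of_real (g x) * \<phi> l x) * H n (\<lambda>t. t ^ k) $$ (l, 0))"
          using i by (simp add: compression_def)
      qed
      \<comment> \<open>Here \<open>\<phi> 0 = 1\<close> almost everywhere turns the inner product
        into a moment of \<open>g\<close>.\<close>
      also have "ip M (\<phi> 0) (\<lambda>x. complex_of_real (g x ^ k) * \<phi> 0 x) =
          (LINT x|M. complex_of_real (g x ^ k))"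
        unfolding ip_def
      proof (rule integral_cong_AE)
        note [measurable] = g sq_integrable_measurable[OF sq]
        have "(\<lambda>x. cnj (\<phi> 0 x)) \<in> borel_measurable M"
          by (rule borel_measurable_continuous_on[OF _ sq_integrable_measurable[OF sq]])
            (intro continuous_intros)
        then show "(\<lambda>x. cnj (\<phi> 0 x) * (complex_of_real (g x ^ k) * \<phi> 0 x)) \<in> borel_measurable M"
          by measurable
        show "(\<lambda>x. complex_of_real (g x ^ k)) \<in> borel_measurable M" by measurable
        show "AE x in M. cnj (\<phi> 0 x) * (complex_of_real (g x ^ k) * \<phi> 0 x) = complex_of_real (g x ^ k)"
          using one by eventually_elim simp
      qed
      finally show ?thesis
        by (simp only: H00 integral_complex_of_real tendsto_of_real_iff)
    qed
  qed (use g bd in \<open>auto simp: p_def\<close>)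
  then show ?thesis
    by (rule that) (simp_all only: fH H H00)
qed

section \<open>The weighted space\<close>

locale weighted_space =
  fixes \<Omega> :: "'a::euclidean_space set" and w :: "'a \<Rightarrow> real"
  assumes \<Omega>: "\<Omega> \<in> sets lebesgue" and w_nonneg: "\<And>x. x \<in> \<Omega> \<Longrightarrow> 0 \<le> w x"
    and w_integrable: "integrable (lebesgue_on \<Omega>) w" and w_integral: "(LINT x|lebesgue_on \<Omega>. w x) = 1"
begin

abbreviation "W \<equiv> weighted_measure \<Omega> w"

lemma space_W: "space W = \<Omega>"
  by (simp add: weighted_measure_def)

lemma borel_measurable_W: "borel_measurable W = borel_measurable (lebesgue_on \<Omega>)"
  unfolding weighted_measure_def by (rule measurable_cong_sets) simp_all

lemma w_measurable [measurable]: "w \<in> borel_measurable (lebesgue_on \<Omega>)"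
  using w_integrable by simp

lemma w_AE: "AE x in lebesgue_on \<Omega>. 0 \<le> w x"
  using w_nonneg by (intro AE_I2) auto

lemma integral_W:
  fixes f :: "'a \<Rightarrow> 'b::{banach, second_countable_topology}"
  assumes "f \<in> borel_measurable (lebesgue_on \<Omega>)"
  shows "(LINT x|W. f x) = (LINT x|lebesgue_on \<Omega>. w x *\<^sub>R f x)"
  unfolding weighted_measure_def using assms w_AE by (intro integral_density) auto

lemma prob_space_W: "prob_space W"
proof
  have "emeasure W (space W) = (\<integral>\<^sup>+x. ennreal (w x) \<partial>lebesgue_on \<Omega>)"
    unfolding weighted_measure_def
    by (subst emeasure_density) (auto intro!: nn_integral_cong)
  also have "\<dots> = 1" using w_integrable w_AE w_integral by (simp add: nn_integral_eq_integral)
  finally show "emeasure W (space W) = 1" .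
qed

lemma L2_iff_sq_integrable: "\<phi> \<in> L2 \<Omega> w \<longleftrightarrow> sq_integrable W \<phi>"
proof (cases "\<phi> \<in> borel_measurable (lebesgue_on \<Omega>)")
  case True
  then have "integrable W (\<lambda>x. (cmod (\<phi> x))\<^sup>2) \<longleftrightarrow>
      integrable (lebesgue_on \<Omega>) (\<lambda>x. w x *\<^sub>R (cmod (\<phi> x))\<^sup>2)"
    unfolding weighted_measure_def using w_AE by (intro integrable_density) auto
  then show ?thesis using True
    by (simp add: L2_def sq_integrable_def borel_measurable_W mult.commute)
qed (simp add: L2_def sq_integrable_def borel_measurable_W)

lemma L2_inner_eq_ip:
  assumes [measurable]: "\<phi> \<in> borel_measurable (lebesgue_on \<Omega>)" "\<psi> \<in> borel_measurable (lebesgue_on \<Omega>)"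
  shows "L2_inner \<Omega> w \<phi> \<psi> = ip W \<phi> \<psi>"
proof -
  have "(\<lambda>x. cnj (\<phi> x)) \<in> borel_measurable (lebesgue_on \<Omega>)"
    by (rule borel_measurable_continuous_on[OF _ assms(1)]) (intro continuous_intros)
  then have "(\<lambda>x. cnj (\<phi> x) * \<psi> x) \<in> borel_measurable (lebesgue_on \<Omega>)" by measurable
  then show ?thesis
    by (simp add: L2_inner_def ip_def integral_W scaleR_conv_of_real mult.commute)
qed

lemma L2_norm_eq_nsq:
  assumes [measurable]: "\<phi> \<in> borel_measurable (lebesgue_on \<Omega>)"
  shows "L2_norm \<Omega> w \<phi> = sqrt (nsq W \<phi>)"
  by (simp add: L2_norm_def nsq_def integral_W mult.commute)

lemma orthonormal_basis_W:
  assumes "L2_orthonormal_basis \<Omega> w \<phi>"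
  shows "orthonormal_basis W \<phi>"
proof
  have sq: "sq_integrable W (\<phi> i)" for i
    using assms by (simp add: L2_orthonormal_basis_def L2_iff_sq_integrable)
  have meas: "\<phi> i \<in> borel_measurable (lebesgue_on \<Omega>)" for i
    using sq_integrable_measurable[OF sq] by (simp add: borel_measurable_W)
  show "sq_integrable W (\<phi> i)" for i by (rule sq)
  show "ip W (\<phi> i) (\<phi> j) = (if i = j then 1 else 0)" for i j
    using assms by (simp add: L2_orthonormal_basis_def L2_inner_eq_ip meas)
  fix \<psi> and \<epsilon> :: real assume \<psi>: "sq_integrable W \<psi>" and "\<epsilon> > 0"
  \<comment> \<open>The locale measures the squared distance, \<open>L2_norm\<close> the distance
    itself.\<close>
  then have "0 < sqrt \<epsilon>" by simp
  then obtain m c where mc: "L2_norm \<Omega> w (\<lambda>x. \<psi> x - (\<Sum>i<m. c i * \<phi> i x)) < sqrt \<epsilon>"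
    using assms \<psi>[folded L2_iff_sq_integrable] unfolding L2_orthonormal_basis_def by blast
  have "sq_integrable W (\<lambda>x. \<psi> x - (\<Sum>i<m. c i * \<phi> i x))"
    by (intro sq_integrable_diff \<psi> sq_integrable_sum sq)
  then have "(\<lambda>x. \<psi> x - (\<Sum>i<m. c i * \<phi> i x)) \<in> borel_measurable (lebesgue_on \<Omega>)"
    by (metis sq_integrable_measurable borel_measurable_W)
  then show "\<exists>m c. nsq W (\<lambda>x. \<psi> x - (\<Sum>i<m. c i * \<phi> i x)) < \<epsilon>"
    using mc by (auto simp: L2_norm_eq_nsq)
qed

lemma mult_matrix_eq_compression:
  assumes "L2_orthonormal_basis \<Omega> w \<phi>" and g: "g \<in> borel_measurable (lebesgue_on \<Omega>)"
  shows "mult_matrix \<Omega> w \<phi> g n = compression W \<phi> g n"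
proof -
  interpret orthonormal_basis W \<phi> by (rule orthonormal_basis_W[OF assms(1)])
  have meas [measurable]: "\<phi> i \<in> borel_measurable (lebesgue_on \<Omega>)" for i
    using sq_integrable_measurable[OF sq] by (simp add: borel_measurable_W)
  have "(\<lambda>x. complex_of_real (g x) * \<phi> i x) \<in> borel_measurable (lebesgue_on \<Omega>)" for i
    using g by measurable
  then show ?thesis
    by (simp add: mult_matrix_def compression_def mult_op_def L2_inner_eq_ip)
qed

lemma AE_W_iff:
  "(AE x in W. P x) \<longleftrightarrow> (AE x in lebesgue_on \<Omega>. 0 < w x \<longrightarrow> P x)"
  unfolding weighted_measure_def by (subst AE_density) auto

text \<open>A vanishing spectral integral gives a nonnegative function of integral zero; where
  \<open>w\<close> is positive, its vanishing forces \<open>g x\<close> out of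
  \<open>C\<close>.\<close>

lemma AE_W_not_in:
  assumes g: "g \<in> borel_measurable (lebesgue_on \<Omega>)" and C: "closed C"
    and zero: "has_spectral_integral \<Omega> w (spectral_family g) C zero_op"
  shows "AE x in W. g x \<notin> C"
proof -
  have Cb: "C \<in> sets borel" using C by simp
  have 0: "(LINT x|lebesgue_on \<Omega>. indicator C (g x) * w x) = 0"
    using zero has_spectral_integral_zero_iff[OF \<Omega> w_nonneg w_integrable g Cb] by simp
  have m: "(\<lambda>x. indicator C (g x) * w x) \<in> borel_measurable (lebesgue_on \<Omega>)"
    using Cb g by measurable
  have int: "integrable (lebesgue_on \<Omega>) (\<lambda>x. indicator C (g x) * w x)"
    by (rule Bochner_Integration.integrable_bound[OF w_integrable m]) (auto simp: indicator_def)
  have "AE x in lebesgue_on \<Omega>. 0 \<le> indicator C (g x) * w x"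
    using w_nonneg by (intro AE_I2) (simp add: indicator_def)
  then have "AE x in lebesgue_on \<Omega>. indicator C (g x) * w x = 0"
    using 0 integral_nonneg_eq_0_iff_AE[OF int] by blast
  then show ?thesis
    unfolding AE_W_iff by eventually_elim (auto simp: indicator_def)
qed

text \<open>Completeness of Lebesgue measure makes the right-hand integrand measurable, whatever the values
  of \<open>f\<close> on the null set \<open>C\<close>.\<close>

lemma integral_W_modify:
  fixes f :: "real \<Rightarrow> real"
  assumes g: "g \<in> borel_measurable (lebesgue_on \<Omega>)" and null: "AE x in W. g x \<notin> C"
    and F: "(\<lambda>t. if t \<in> C then 0 else f t) \<in> borel_measurable borel"
  shows "(LINT x|W. (if g x \<in> C then 0 else f (g x))) = (LINT x|lebesgue_on \<Omega>. f (g x) * w x)"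
proof -
  define u where "u x = w x * (if g x \<in> C then 0 else f (g x))" for x
  have Fg: "(\<lambda>x. if g x \<in> C then 0 else f (g x)) \<in> borel_measurable (lebesgue_on \<Omega>)"
    using measurable_compose[OF g F] .
  then have u: "u \<in> borel_measurable (lebesgue_on \<Omega>)"
    unfolding u_def[abs_def] by measurable
  \<comment> \<open>Where \<open>w\<close> is positive, \<open>g x\<close> almost surely avoids
    \<open>C\<close>; where \<open>w\<close> is 0, both sides vanish.\<close>
  have ae: "AE x in lebesgue_on \<Omega>. u x = f (g x) * w x"
    using null[unfolded AE_W_iff] w_AE by eventually_elim (auto simp: u_def)
  have v: "(\<lambda>x. f (g x) * w x) \<in> borel_measurable (lebesgue_on \<Omega>)"
  proof (rule borel_measurable_if_D)
    \<comment> \<open>Extension by zero moves the question to the whole space, where a function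
      equal almost everywhere to a measurable one is measurable.\<close>
    show "(\<lambda>x. if x \<in> \<Omega> then f (g x) * w x else 0) \<in> borel_measurable lebesgue"
    proof (rule borel_measurable_AE)
      show "(\<lambda>x. if x \<in> \<Omega> then u x else 0) \<in> borel_measurable lebesgue"
        by (rule borel_measurable_if_I[OF u \<Omega>])
      show "AE x in lebesgue. (if x \<in> \<Omega> then u x else 0) = (if x \<in> \<Omega> then f (g x) * w x else 0)"
        using ae \<Omega> by (simp add: AE_restrict_space_iff)
    qed
  qed
  have "(LINT x|W. (if g x \<in> C then 0 else f (g x))) = (LINT x|lebesgue_on \<Omega>. u x)"
    by (simp add: integral_W[OF Fg] u_def)
  also have "\<dots> = (LINT x|lebesgue_on \<Omega>. f (g x) * w x)"
    by (rule integral_cong_AE[OF u v ae])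
  finally show ?thesis .
qed

end

text \<open>Elements of the space are classes of functions, so \<open>\<phi> 0\<close> is prescribed
  only almost everywhere. The limit is stated in the complex numbers because the matrices are
  complex.\<close>

theorem theorem5:
  fixes \<Omega> :: "(real ^ 'd) set" and w g :: "real ^ 'd \<Rightarrow> real"
    and \<phi> :: "nat \<Rightarrow> real ^ 'd \<Rightarrow> complex" and f :: "real \<Rightarrow> real"
  assumes "\<Omega> \<in> sets lebesgue"
    and "\<forall>x\<in>\<Omega>. 0 \<le> w x"
    and "integrable (lebesgue_on \<Omega>) w"
    and "(LINT x|lebesgue_on \<Omega>. w x) = 1"
    and "L2_orthonormal_basis \<Omega> w \<phi>"
    and "AE x in weighted_measure \<Omega> w. \<phi> 0 x = 1"
    and "g \<in> borel_measurable (lebesgue_on \<Omega>)"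
    and "bounded (g ` \<Omega>)"
    and "bounded (range f)"
    and "has_spectral_integral \<Omega> w (spectral_family g) (closure {t. \<not> isCont f t}) zero_op"
  shows "(\<forall>n. hermitian_fun f (mult_matrix \<Omega> w \<phi> g n) $$ (0, 0) =
            scalar_prod (unit_vec (n + 1) 0)
              (hermitian_fun f (mult_matrix \<Omega> w \<phi> g n) *\<^sub>v unit_vec (n + 1) 0)) \<and>
         (\<lambda>n. hermitian_fun f (mult_matrix \<Omega> w \<phi> g n) $$ (0, 0))
           \<longlonglongrightarrow> complex_of_real (LINT x|lebesgue_on \<Omega>. f (g x) * w x)"
proof -
  interpret weighted_space \<Omega> w using assms(1-4) by unfold_locales auto
  interpret orthonormal_basis W \<phi> by (rule orthonormal_basis_W[OF assms(5)])
  have A: "mult_matrix \<Omega> w \<phi> g n = compression W \<phi> g n" for n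
    by (rule mult_matrix_eq_compression[OF assms(5,7)])
  obtain G where G: "\<And>x. x \<in> \<Omega> \<Longrightarrow> \<bar>g x\<bar> \<le> G"
    using assms(8) by (auto simp: bounded_iff)
  obtain B where B: "\<And>t. \<bar>f t\<bar> \<le> B"
    using assms(9) by (auto simp: bounded_iff)
  obtain p ev where quad: "moment_quadrature W g G p ev"
    and carrier: "\<And>n. hermitian_fun f (compression W \<phi> g n) \<in> carrier_mat (Suc n) (Suc n)"
    and entry: "\<And>n. hermitian_fun f (compression W \<phi> g n) $$ (0, 0) =
      complex_of_real (\<Sum>j<Suc n. p n j * f (ev n j))"
  proof (rule compression_quadrature[OF prob_space_W _ _ assms(6), of g G])
    show "g \<in> borel_measurable W" using assms(7) by (simp add: borel_measurable_W)
    show "\<bar>g x\<bar> \<le> G" if "x \<in> space W" for x using that by (simp add: space_W G)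
  qed (use that in blast)
  interpret moment_quadrature W g G p ev by (rule quad)
  \<comment> \<open>The extra point outside the range of \<open>g\<close> makes \<open>C\<close> nonempty.\<close>
  define C where "C = insert (G + 1) (closure {t. \<not> isCont f t})"
  have C: "closed C" "C \<noteq> {}" by (auto simp: C_def)
  have null: "AE x in W. g x \<notin> C"
    using AE_W_not_in[OF assms(7) closed_closure assms(10)] AE_space[of W]
  proof eventually_elim
    case (elim x)
    then show ?case using G[of x] by (auto simp: C_def space_W)
  qed
  have f: "isCont f t" if "t \<notin> C" for t
    using that closure_subset[of "{t. \<not> isCont f t}"] by (auto simp: C_def)
  note lim = almost_continuous_converge[OF C f B null]
  have "(\<lambda>n. \<Sum>j<Suc n. p n j * f (ev n j)) \<longlonglongrightarrow> (LINT x|lebesgue_on \<Omega>. f (g x) * w x)"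
    using lim(2) integral_W_modify[OF assms(7) null lim(1)] by simp
  then have "(\<lambda>n. hermitian_fun f (mult_matrix \<Omega> w \<phi> g n) $$ (0, 0))
      \<longlonglongrightarrow> complex_of_real (LINT x|lebesgue_on \<Omega>. f (g x) * w x)"
    unfolding A entry by (rule tendsto_of_real)
  moreover have "X $$ (0, 0) = scalar_prod (unit_vec (n + 1) 0) (X *\<^sub>v unit_vec (n + 1) 0)"
    if "X \<in> carrier_mat (Suc n) (Suc n)" for X :: "complex mat" and n
    using that by (simp add: scalar_prod_left_unit)
  ultimately show ?thesis
    unfolding A using carrier by blast
qed

end
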